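(* Let $X$ be a compact oriented manifold of dimension $m$, and let $(g_t,\Omega_t)_{t\in(-\varepsilon,\varepsilon)}\subset\mathcal M\times\mathcal V_1$ be a $G$-geodesic such that $(\dot g_0,\dot\Omega_0)\in\mathbb F_{g_0,\Omega_0}$. Then $(\dot g_t,\dot\Omega_t)\in\mathbb F_{g_t,\Omega_t}$ for all $t\in(-\varepsilon,\varepsilon)$.
   Context: $\mathcal M$ is the space of smooth Riemannian metrics on $X$ and $\mathcal V_1$ is the space of smooth positive volume forms on $X$ with integral one. The tangent space of $\mathcal M\times\mathcal V_1$ is $T_{\mathcal M\times\mathcal V_1}=C^\infty(X,S^2T_X^* )\oplus\{V\in C^\infty(X,\Lambda^mT_X^* )\mid\int_XV=0\}$. For $(g,\Omega)\in\mathcal M\times\mathcal V_1$ and a tangent vector $(v,V)$ put $v_g^*:=g^{-1}v$ (the $g$-symmetric endomorphism of $T_X$ with $v(\xi,\eta)=g(v_g^*\xi,\eta)$) and $V_\Omega^*:=V/\Omega$ (a function). Dots denote $t$-derivatives; along a path $(g_t,\Omega_t)$ write $\dot g_t^*:=g_t^{-1}\dot g_t$, $\dot\Omega_t^*:=\dot\Omega_t/\Omega_t$. The pseudo-Riemannian metric $G$ on $\mathcal M\times\mathcal V_1$ is $$G_{g,\Omega}(u,U;v,V)=\int_X\big[\langle u,v\rangle_g-2U_\Omega^*V_\Omega^*\big]\Omega,\qquad \langle u,v\rangle_g=\operatorname{Tr}_{\mathbb R}(u_g^*v_g^* ).$$ A $G$-geodesic is a smooth path $(g_t,\Omega_t)\subset\mathcal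 M\times\mathcal V_1$ satisfying the geodesic equation of $G$, which is the system $$\frac{d}{dt}\dot g_t^*+\dot\Omega_t^*\dot g_t^*=0,\qquad \ddot\Omega_t+\frac14\Big\{|\dot g_t|_{g_t}^2-2(\dot\Omega_t^* )^2-\int_X\big[|\dot g_t|_{g_t}^2-2(\dot\Omega_t^* )^2\big]\Omega_t\Big\}\Omega_t=0 .$$ For $A\in C^\infty(X,\operatorname{End}(T_X))$, $\nabla_g^{*_\Omega}A$ is the vector field obtained by applying the formal adjoint, with respect to $g$ and the volume form $\Omega$, of the Levi-Civita connection $\nabla_g$: $\int_Xg(\nabla_g^{*_\Omega}A,\xi)\,\Omega=\int_X\langle A,\nabla_g\xi\rangle_g\,\Omega$ for all vector fields $\xi$; that is, $\nabla_g^{*_\Omega}A=-\sum_k(\nabla_{g,e_k}A)e_k+A\nabla_g\log\frac{dV_g}{\Omega}$ for a local $g$-orthonormal frame $(e_k)$. For a function $f$, $\nabla_gf$ is its $g$-gradient. Finally $$\mathbb F_{g,\Omega}:=\{(v,V)\in T_{\mathcal M\times\mathcal V_1}\mid\nabla_g^{*_\Omega}v_g^*+\nabla_gV_\Omega^*=0\}.$$ *)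

theory Defs
  imports "HOL-Analysis.Analysis"
begin

section \<open>Smooth maps on open sets\<close>

text \<open>For open \<open>S\<close>, \<open>cont_diff_on S f n\<close> says that \<open>f\<close> is \<open>n\<close> times continuously
  differentiable on \<open>S\<close>.\<close>

primrec cont_diff_on ::
    "'a::real_normed_vector set \<Rightarrow> ('a \<Rightarrow> 'b::real_normed_vector) \<Rightarrow> nat \<Rightarrow> bool" where
  "cont_diff_on S f 0 \<longleftrightarrow> continuous_on S f"
| "cont_diff_on S f (Suc n) \<longleftrightarrow> (\<forall>x\<in>S. f differentiable at x) \<and>
     (\<forall>v. cont_diff_on S (\<lambda>x. frechet_derivative f (at x) v) n)"

definition smooth_on ::
    "'a::real_normed_vector set \<Rightarrow> ('a \<Rightarrow> 'b::real_normed_vector) \<Rightarrow> bool" where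
  "smooth_on S f \<longleftrightarrow> (\<forall>n. cont_diff_on S f n)"


section \<open>Compact oriented manifolds\<close>

text \<open>A chart is a pair of a domain and a coordinate map (whose values outside the domain are
  irrelevant).\<close>

type_synonym ('a, 'm) chart = "'a set \<times> ('a \<Rightarrow> real^'m)"

definition chart_image :: "('a, 'm::finite) chart \<Rightarrow> (real^'m) set" where
  "chart_image c = snd c ` fst c"

definition chart_inv :: "('a, 'm::finite) chart \<Rightarrow> real^'m \<Rightarrow> 'a" where
  "chart_inv c = inv_into (fst c) (snd c)"

definition overlap :: "('a, 'm::finite) chart \<Rightarrow> ('a, 'm) chart \<Rightarrow> (real^'m) set" where
  "overlap c d = snd c ` (fst c \<inter> fst d)"

definition transition :: "('a, 'm::finite) chart \<Rightarrow> ('a, 'm) chart \<Rightarrow> real^'m \<Rightarrow> real^'m" where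
  "transition c d = snd d \<circ> chart_inv c"

definition transition_jacobian ::
    "('a, 'm::finite) chart \<Rightarrow> ('a, 'm) chart \<Rightarrow> real^'m \<Rightarrow> real^'m^'m" where
  "transition_jacobian c d x = jacobian (transition c d) (at x)"

definition is_chart :: "('a::topological_space, 'm::finite) chart \<Rightarrow> bool" where
  "is_chart c \<longleftrightarrow> open (fst c) \<and> open (chart_image c) \<and>
     homeomorphism (fst c) (chart_image c) (snd c) (chart_inv c)"

definition oriented_smooth_atlas :: "('a::topological_space, 'm::finite) chart set \<Rightarrow> bool" where
  "oriented_smooth_atlas A \<longleftrightarrow>
     (\<forall>c\<in>A. is_chart c) \<and> (\<Union>c\<in>A. fst c) = UNIV \<and>
     (\<forall>c\<in>A. \<forall>d\<in>A. smooth_on (overlap c d) (transition c d) \<and>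
        (\<forall>x\<in>overlap c d. det (transition_jacobian c d x) > 0))"

text \<open>The underlying space is the type \<open>'a\<close>. It is Hausdorff by its sort; second countability
  follows from compactness and the existence of charts.\<close>

definition compact_oriented_manifold :: "('a::t2_space, 'm::finite) chart set \<Rightarrow> bool" where
  "compact_oriented_manifold A \<longleftrightarrow> compact (UNIV :: 'a set) \<and> oriented_smooth_atlas A"


section \<open>Tensor fields\<close>

text \<open>A field assigns to each chart its components in that chart, as a function of the
  coordinates. Only its values for charts \<open>c\<close> of the atlas and points of \<open>chart_image c\<close> matter.
  A covariant 2-tensor has components \<open>v $ i $ j = v\<^bsub>ij\<^esub>\<close>, an endomorphism of the tangent
  bundle \<open>E $ i $ j = E\<^sup>i\<^bsub>j\<^esub>\<close>, and an \<open>m\<close>-form is represented by its coefficient with respect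
  to \<open>dx\<^sup>1 \<and> \<dots> \<and> dx\<^sup>m\<close>. A function on the manifold has the same value in all charts around a
  point.\<close>

type_synonym ('a, 'm, 'b) field = "('a, 'm) chart \<Rightarrow> real^'m \<Rightarrow> 'b"
type_synonym ('a, 'm) scalar_field = "('a, 'm, real) field"
type_synonym ('a, 'm) vector_field = "('a, 'm, real^'m) field"
type_synonym ('a, 'm) matrix_field = "('a, 'm, real^'m^'m) field"

text \<open>\<open>C\<^sup>\<infinity>(X, S\<^sup>2T\<^sub>X\<^sup>*)\<close>.\<close>

definition symmetric_tensors :: "('a, 'm::finite) chart set \<Rightarrow> ('a, 'm) matrix_field set" where
  "symmetric_tensors A = {v. \<forall>c\<in>A. smooth_on (chart_image c) (v c) \<and>
     (\<forall>x\<in>chart_image c. transpose (v c x) = v c x) \<and>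
     (\<forall>d\<in>A. \<forall>x\<in>overlap c d. v c x =
        transpose (transition_jacobian c d x) ** v d (transition c d x) **
          transition_jacobian c d x)}"

definition riemannian_metrics :: "('a, 'm::finite) chart set \<Rightarrow> ('a, 'm) matrix_field set" where
  "riemannian_metrics A = {g \<in> symmetric_tensors A.
     \<forall>c\<in>A. \<forall>x\<in>chart_image c. \<forall>\<xi>. \<xi> \<noteq> 0 \<longrightarrow> \<xi> \<bullet> (g c x *v \<xi>) > 0}"

text \<open>\<open>C\<^sup>\<infinity>(X, \<Lambda>\<^sup>mT\<^sub>X\<^sup>*)\<close>.\<close>

definition top_forms :: "('a, 'm::finite) chart set \<Rightarrow> ('a, 'm) scalar_field set" where
  "top_forms A = {V. \<forall>c\<in>A. smooth_on (chart_image c) (V c) \<and>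
     (\<forall>d\<in>A. \<forall>x\<in>overlap c d. V c x = det (transition_jacobian c d x) * V d (transition c d x))}"

text \<open>Integration of \<open>m\<close>-forms by a finite partition of unity subordinate to the atlas. The value
  does not depend on the partition, and continuous ones suffice.\<close>

definition partition_of_unity ::
    "('a::topological_space, 'm::finite) chart set \<Rightarrow>
      ('a, 'm) chart set \<times> (('a, 'm) chart \<Rightarrow> 'a \<Rightarrow> real) \<Rightarrow> bool" where
  "partition_of_unity A = (\<lambda>(C, \<rho>). finite C \<and> C \<subseteq> A \<and>
     (\<forall>c\<in>C. continuous_on UNIV (\<rho> c) \<and> (\<forall>p. 0 \<le> \<rho> c p) \<and> closure {p. \<rho> c p \<noteq> 0} \<subseteq> fst c) \<and>
     (\<forall>p. (\<Sum>c\<in>C. \<rho> c p) = 1))"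

definition form_integral ::
    "('a::topological_space, 'm::finite) chart set \<Rightarrow> ('a, 'm) scalar_field \<Rightarrow> real" where
  "form_integral A V = (let (C, \<rho>) = (SOME P. partition_of_unity A P) in
     \<Sum>c\<in>C. integral (chart_image c) (\<lambda>x. \<rho> c (chart_inv c x) * V c x))"

text \<open>Positivity is with respect to the orientation given by the atlas.\<close>

definition unit_volume_forms ::
    "('a::topological_space, 'm::finite) chart set \<Rightarrow> ('a, 'm) scalar_field set" where
  "unit_volume_forms A = {\<Omega> \<in> top_forms A.
     (\<forall>c\<in>A. \<forall>x\<in>chart_image c. \<Omega> c x > 0) \<and> form_integral A \<Omega> = 1}"

definition tangent_space ::
    "('a::topological_space, 'm::finite) chart set \<Rightarrow>
      (('a, 'm) matrix_field \<times> ('a, 'm) scalar_field) set" where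
  "tangent_space A = {(v, V). v \<in> symmetric_tensors A \<and> V \<in> top_forms A \<and> form_integral A V = 0}"


section \<open>The metric \<open>G\<close> and its geodesics\<close>

text \<open>\<open>v\<^sub>g\<^sup>* = g\<^sup>-\<^sup>1v\<close> and \<open>V\<^sub>\<Omega>\<^sup>* = V/\<Omega>\<close>.\<close>

definition endo ::
    "('a, 'm::finite) matrix_field \<Rightarrow> ('a, 'm) matrix_field \<Rightarrow> ('a, 'm) matrix_field" where
  "endo g v c x = matrix_inv (g c x) ** v c x"

definition form_quotient ::
    "('a, 'm::finite) scalar_field \<Rightarrow> ('a, 'm) scalar_field \<Rightarrow> ('a, 'm) scalar_field" where
  "form_quotient \<Omega> V c x = V c x / \<Omega> c x"

definition tensor_inner ::
    "('a, 'm::finite) matrix_field \<Rightarrow> ('a, 'm) matrix_field \<Rightarrow> ('a, 'm) matrix_field \<Rightarrow>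
      ('a, 'm) scalar_field" where
  "tensor_inner g u v c x = trace (endo g u c x ** endo g v c x)"

definition G_density ::
    "('a, 'm::finite) matrix_field \<Rightarrow> ('a, 'm) scalar_field \<Rightarrow>
      ('a, 'm) matrix_field \<times> ('a, 'm) scalar_field \<Rightarrow>
      ('a, 'm) matrix_field \<times> ('a, 'm) scalar_field \<Rightarrow> ('a, 'm) scalar_field" where
  "G_density g \<Omega> = (\<lambda>(u, U) (v, V) c x.
     tensor_inner g u v c x - 2 * form_quotient \<Omega> U c x * form_quotient \<Omega> V c x)"

definition G_metric ::
    "('a::topological_space, 'm::finite) chart set \<Rightarrow>
      ('a, 'm) matrix_field \<Rightarrow> ('a, 'm) scalar_field \<Rightarrow>
      ('a, 'm) matrix_field \<times> ('a, 'm) scalar_field \<Rightarrow>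
      ('a, 'm) matrix_field \<times> ('a, 'm) scalar_field \<Rightarrow> real" where
  "G_metric A g \<Omega> a b = form_integral A (\<lambda>c x. G_density g \<Omega> a b c x * \<Omega> c x)"

definition time_deriv ::
    "(real \<Rightarrow> ('a, 'm::finite, 'b::real_normed_vector) field) \<Rightarrow> real \<Rightarrow> ('a, 'm, 'b) field" where
  "time_deriv h t c x = vector_derivative (\<lambda>s. h s c x) (at t)"

text \<open>Smoothness of a path of fields is joint smoothness in time and space.\<close>

definition smooth_path ::
    "('a::topological_space, 'm::finite) chart set \<Rightarrow> real \<Rightarrow>
      (real \<Rightarrow> ('a, 'm) matrix_field) \<Rightarrow> (real \<Rightarrow> ('a, 'm) scalar_field) \<Rightarrow> bool" where
  "smooth_path A \<epsilon> g \<Omega> \<longleftrightarrow>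
     (\<forall>t\<in>{-\<epsilon><..<\<epsilon>}. g t \<in> riemannian_metrics A \<and> \<Omega> t \<in> unit_volume_forms A) \<and>
     (\<forall>c\<in>A. smooth_on ({-\<epsilon><..<\<epsilon>} \<times> chart_image c) (\<lambda>(t, x). g t c x) \<and>
            smooth_on ({-\<epsilon><..<\<epsilon>} \<times> chart_image c) (\<lambda>(t, x). \<Omega> t c x))"

text \<open>In the second equation, \<open>G_density\<close> and \<open>G_metric\<close> at the velocity are
  \<open>|g'|\<^sup>2 - 2(\<Omega>'\<^sup>*)\<^sup>2\<close> and its integral against \<open>\<Omega>\<close>.\<close>

definition G_geodesic ::
    "('a::topological_space, 'm::finite) chart set \<Rightarrow> real \<Rightarrow>
      (real \<Rightarrow> ('a, 'm) matrix_field) \<Rightarrow> (real \<Rightarrow> ('a, 'm) scalar_field) \<Rightarrow> bool" where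
  "G_geodesic A \<epsilon> g \<Omega> \<longleftrightarrow> smooth_path A \<epsilon> g \<Omega> \<and>
     (\<forall>t\<in>{-\<epsilon><..<\<epsilon>}. \<forall>c\<in>A. \<forall>x\<in>chart_image c.
        time_deriv (\<lambda>s. endo (g s) (time_deriv g s)) t c x
          + form_quotient (\<Omega> t) (time_deriv \<Omega> t) c x *\<^sub>R endo (g t) (time_deriv g t) c x = 0 \<and>
        time_deriv (time_deriv \<Omega>) t c x
          + 1/4 * (G_density (g t) (\<Omega> t) (time_deriv g t, time_deriv \<Omega> t)
                      (time_deriv g t, time_deriv \<Omega> t) c x
                   - G_metric A (g t) (\<Omega> t) (time_deriv g t, time_deriv \<Omega> t)
                      (time_deriv g t, time_deriv \<Omega> t)) * \<Omega> t c x = 0)"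


section \<open>The Levi-Civita connection and the space \<open>F\<close>\<close>

definition partial_deriv ::
    "'m::finite \<Rightarrow> (real^'m \<Rightarrow> 'b::real_normed_vector) \<Rightarrow> real^'m \<Rightarrow> 'b" where
  "partial_deriv k f x = frechet_derivative f (at x) (axis k 1)"

text \<open>\<open>christoffel g c x i k j = \<Gamma>\<^sup>i\<^bsub>kj\<^esub>\<close>; the endomorphism \<open>connection_form g c x \<xi>\<close> is
  \<open>\<eta> \<mapsto> \<Gamma>(\<xi>, \<eta>)\<close>.\<close>

definition christoffel ::
    "('a, 'm::finite) matrix_field \<Rightarrow> ('a, 'm) chart \<Rightarrow> real^'m \<Rightarrow> 'm \<Rightarrow> 'm \<Rightarrow> 'm \<Rightarrow> real" where
  "christoffel g c x i k j = 1/2 * (\<Sum>l\<in>UNIV. matrix_inv (g c x) $ i $ l *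
     (partial_deriv k (\<lambda>y. g c y $ l $ j) x + partial_deriv j (\<lambda>y. g c y $ l $ k) x
        - partial_deriv l (\<lambda>y. g c y $ k $ j) x))"

definition connection_form ::
    "('a, 'm::finite) matrix_field \<Rightarrow> ('a, 'm) chart \<Rightarrow> real^'m \<Rightarrow> real^'m \<Rightarrow> real^'m^'m" where
  "connection_form g c x \<xi> = (\<chi> i j. \<Sum>k\<in>UNIV. \<xi> $ k * christoffel g c x i k j)"

text \<open>\<open>cov_deriv g E c x \<xi>\<close> is \<open>(\<nabla>\<^bsub>g,\<xi>\<^esub>E)(x)\<close> for a field \<open>E\<close> of endomorphisms.\<close>

definition cov_deriv ::
    "('a, 'm::finite) matrix_field \<Rightarrow> ('a, 'm) matrix_field \<Rightarrow>
      ('a, 'm) chart \<Rightarrow> real^'m \<Rightarrow> real^'m \<Rightarrow> real^'m^'m" where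
  "cov_deriv g E c x \<xi> = frechet_derivative (E c) (at x) \<xi>
     + connection_form g c x \<xi> ** E c x - E c x ** connection_form g c x \<xi>"

definition grad ::
    "('a, 'm::finite) matrix_field \<Rightarrow> ('a, 'm) scalar_field \<Rightarrow> ('a, 'm) vector_field" where
  "grad g f c x = matrix_inv (g c x) *v (\<chi> j. partial_deriv j (f c) x)"

definition metric_volume :: "('a, 'm::finite) matrix_field \<Rightarrow> ('a, 'm) scalar_field" where
  "metric_volume g c x = sqrt (det (g c x))"

text \<open>The formal adjoint of the Levi-Civita connection with respect to \<open>g\<close> and \<open>\<Omega>\<close> on
  endomorphisms. The trace over a \<open>g\<close>-orthonormal frame is written as a contraction with the
  inverse metric; see \<open>nabla_adjoint_orthonormal_frame\<close> below.\<close>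

definition nabla_adjoint ::
    "('a, 'm::finite) matrix_field \<Rightarrow> ('a, 'm) scalar_field \<Rightarrow> ('a, 'm) matrix_field \<Rightarrow>
      ('a, 'm) vector_field" where
  "nabla_adjoint g \<Omega> E c x =
     - (\<Sum>k\<in>UNIV. \<Sum>l\<in>UNIV. matrix_inv (g c x) $ k $ l *\<^sub>R
          (cov_deriv g E c x (axis k 1) *v axis l 1))
     + E c x *v grad g (\<lambda>d y. ln (metric_volume g d y / \<Omega> d y)) c x"

definition F_space ::
    "('a::topological_space, 'm::finite) chart set \<Rightarrow>
      ('a, 'm) matrix_field \<Rightarrow> ('a, 'm) scalar_field \<Rightarrow>
      (('a, 'm) matrix_field \<times> ('a, 'm) scalar_field) set" where
  "F_space A g \<Omega> = {(v, V) \<in> tangent_space A. \<forall>c\<in>A. \<forall>x\<in>chart_image c.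
     nabla_adjoint g \<Omega> (endo g v) c x + grad g (form_quotient \<Omega> V) c x = 0}"

lemma matrix_inv_orthonormal_frame:
  fixes M :: "real^'m::finite^'m" and e :: "'m \<Rightarrow> real^'m"
  assumes "\<And>i j. e i \<bullet> (M *v e j) = (if i = j then 1 else 0)"
  shows "matrix_inv M $ a $ b = (\<Sum>k\<in>UNIV. e k $ a * e k $ b)"
proof -
  define E where "E = (\<chi> i k. e k $ i)"
  have "(transpose E ** (M ** E)) $ i $ j = e i \<bullet> (M *v e j)" for i j
    by (simp add: E_def matrix_matrix_mult_def transpose_def inner_vec_def matrix_vector_mult_def)
  then have "transpose E ** (M ** E) = mat 1"
    using assms by (simp add: vec_eq_iff mat_def)
  then have "(transpose E ** M) ** E = mat 1"
    by (simp add: matrix_mul_assoc)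
  then have "E ** (transpose E ** M) = mat 1"
    by (simp add: matrix_left_right_inverse)
  then have l: "(E ** transpose E) ** M = mat 1"
    by (simp add: matrix_mul_assoc)
  then have r: "M ** (E ** transpose E) = mat 1"
    by (simp add: matrix_left_right_inverse)
  have "M ** matrix_inv M = mat 1 \<and> matrix_inv M ** M = mat 1"
    unfolding matrix_inv_def by (rule someI_ex) (use l r in blast)
  then have "matrix_inv M ** (M ** (E ** transpose E)) = E ** transpose E"
    by (simp add: matrix_mul_assoc)
  then have "matrix_inv M = E ** transpose E"
    by (simp add: r)
  then show ?thesis
    by (simp add: E_def matrix_matrix_mult_def transpose_def)
qed

lemma cov_deriv_expand:
  fixes g :: "('a, 'm::finite) matrix_field"
  assumes "E c differentiable at x"
  shows "cov_deriv g E c x \<xi> *v \<eta> =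
    (\<Sum>k\<in>UNIV. \<Sum>l\<in>UNIV. (\<xi> $ k * \<eta> $ l) *\<^sub>R (cov_deriv g E c x (axis k 1) *v axis l 1))"
proof -
  have lin: "linear (frechet_derivative (E c) (at x))"
    using assms by (rule linear_frechet_derivative)
  have con: "linear (connection_form g c x)"
    by (rule linearI) (simp_all add: connection_form_def vec_eq_iff distrib_right
        sum.distrib sum_distrib_left mult.assoc)
  have l1: "linear (\<lambda>\<xi>. cov_deriv g E c x \<xi> *v \<eta>)" for \<eta>
    by (rule linearI)
      (simp_all add: cov_deriv_def linear_add[OF lin] linear_add[OF con] linear_scale[OF lin]
        linear_scale[OF con] matrix_vector_mult_add_rdistrib matrix_vector_mult_diff_rdistrib
        matrix_vector_mul_assoc[symmetric] scaleR_matrix_vector_assoc[symmetric]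
        matrix_vector_right_distrib matrix_vector_mult_scaleR scaleR_add_right scaleR_diff_right)
  have x: "\<xi> = (\<Sum>k\<in>UNIV. \<xi> $ k *\<^sub>R axis k 1)" for \<xi> :: "real^'m"
    using basis_expansion[of \<xi>] by (simp add: scalar_mult_eq_scaleR)
  have "cov_deriv g E c x \<xi> *v \<eta> = (\<Sum>k\<in>UNIV. \<xi> $ k *\<^sub>R (cov_deriv g E c x (axis k 1) *v \<eta>))"
    by (subst x[of \<xi>]) (simp add: linear_sum[OF l1] linear_scale[OF l1])
  also have "\<dots> = (\<Sum>k\<in>UNIV. \<xi> $ k *\<^sub>R
      (\<Sum>l\<in>UNIV. \<eta> $ l *\<^sub>R (cov_deriv g E c x (axis k 1) *v axis l 1)))"
    by (subst x[of \<eta>]) (simp add: linear_sum[OF matrix_vector_mul_linear]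
        linear_scale[OF matrix_vector_mul_linear])
  finally show ?thesis
    by (simp add: scaleR_sum_right)
qed

lemma nabla_adjoint_orthonormal_frame:
  fixes g :: "('a, 'm::finite) matrix_field" and e :: "'m \<Rightarrow> real^'m"
  assumes "E c differentiable at x"
    and frame: "\<And>i j. e i \<bullet> (g c x *v e j) = (if i = j then 1 else 0)"
  shows "nabla_adjoint g \<Omega> E c x =
    - (\<Sum>k\<in>UNIV. cov_deriv g E c x (e k) *v e k)
    + E c x *v grad g (\<lambda>d y. ln (metric_volume g d y / \<Omega> d y)) c x"
proof -
  let ?D = "\<lambda>k l. cov_deriv g E c x (axis k 1) *v axis l 1"
  have "(\<Sum>j\<in>UNIV. cov_deriv g E c x (e j) *v e j)
      = (\<Sum>j\<in>UNIV. \<Sum>k\<in>UNIV. \<Sum>l\<in>UNIV. (e j $ k * e j $ l) *\<^sub>R ?D k l)"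
    by (intro sum.cong refl cov_deriv_expand assms(1))
  also have "\<dots> = (\<Sum>k\<in>UNIV. \<Sum>j\<in>UNIV. \<Sum>l\<in>UNIV. (e j $ k * e j $ l) *\<^sub>R ?D k l)"
    by (rule sum.swap)
  also have "\<dots> = (\<Sum>k\<in>UNIV. \<Sum>l\<in>UNIV. \<Sum>j\<in>UNIV. (e j $ k * e j $ l) *\<^sub>R ?D k l)"
    by (rule sum.cong[OF refl]) (rule sum.swap)
  also have "\<dots> = (\<Sum>k\<in>UNIV. \<Sum>l\<in>UNIV. matrix_inv (g c x) $ k $ l *\<^sub>R ?D k l)"
    by (simp add: matrix_inv_orthonormal_frame[of e "g c x", OF frame] scaleR_sum_left)
  finally show ?thesis
    by (simp add: nabla_adjoint_def)
qed

end

theory Submission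
  imports Defs
begin

text \<open>Write \<open>E = g\<^sup>-\<^sup>1g'\<close> and \<open>f = \<Omega>'/\<Omega>\<close>, and let \<open>N = \<nabla>\<^sup>*E + \<nabla>f\<close> be the vector field whose vanishing
  defines \<open>F\<close>. In every chart the density \<open>\<Omega> (gN)\<^sub>j\<close> is a conserved quantity of the geodesic flow at each
  point, so it vanishes for all times if it vanishes initially.

  To see this, express the density by coordinate derivatives (\<open>F_condition_coordinates\<close>):
  \<open>\<Omega> (gN)\<^sub>j = - \<Sum>\<^sub>i \<partial>\<^sub>i(\<Omega>E\<^sup>i\<^sub>j) + 1/2 Tr(g\<^sup>-\<^sup>1 \<partial>\<^sub>jg \<Omega>E) + \<partial>\<^sub>j\<Omega>' - f \<partial>\<^sub>j\<Omega>\<close>.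
  The first geodesic equation is \<open>E' = - fE\<close>. Together with \<open>\<Omega>' = f\<Omega>\<close> it says that \<open>\<Omega>E\<close> does not depend on
  time. So the first term is constant in time, and in the second one only \<open>g\<^sup>-\<^sup>1 \<partial>\<^sub>jg\<close> varies. Because
  \<open>g' = gE\<close> and mixed derivatives commute, the time derivative of \<open>g\<^sup>-\<^sup>1 \<partial>\<^sub>jg\<close> is \<open>\<partial>\<^sub>jE\<close> plus a commutator
  with \<open>E\<close>, and the second term changes at the rate \<open>1/2 \<Omega> Tr(E \<partial>\<^sub>jE)\<close>. The remaining terms are
  \<open>\<Omega> \<partial>\<^sub>jf\<close>. The second geodesic equation reads \<open>f' + f\<^sup>2/2 + 1/4 Tr(E\<^sup>2) = const\<close>, where the constant
  depends on time only; differentiated in direction \<open>j\<close> it shows that \<open>\<Omega> \<partial>\<^sub>jf\<close> changes at the opposite rate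
  (\<open>F_condition_conserved\<close>).

  Membership in \<open>F\<close> also requires that the velocity is tangent to the space of metrics and unit volume
  forms (\<open>smooth_path_velocity_tangent\<close>). The point there is that the integral of \<open>\<Omega>'\<close> vanishes: it is the
  derivative of the constant one, by differentiation under the integrals that a partition of unity
  yields.\<close>


section \<open>Smooth families and their time derivatives\<close>

lemma frechet_derivative_eqI: "(f has_derivative f') (at x) \<Longrightarrow> frechet_derivative f (at x) = f'"
  by (rule frechet_derivative_at[symmetric])

lemma cont_diff_on_cong:
  assumes "open S" "\<And>x. x \<in> S \<Longrightarrow> f x = h x" "cont_diff_on S f n"
  shows "cont_diff_on S h n"
  using assms(2,3)
proof (induction n arbitrary: f h)
  case 0
  then show ?case by (simp cong: continuous_on_cong)
next
  case (Suc n)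
  have d: "f differentiable at x" if "x \<in> S" for x
    using Suc.prems that by auto
  have hd: "(h has_derivative frechet_derivative f (at x)) (at x)" if "x \<in> S" for x
    using has_derivative_transform_within_open[OF d[OF that, unfolded frechet_derivative_works] assms(1) that]
      Suc.prems(1) by blast
  have "cont_diff_on S (\<lambda>x. frechet_derivative h (at x) v) n" for v
    by (rule Suc.IH[of "\<lambda>x. frechet_derivative f (at x) v"])
      (use Suc.prems frechet_derivative_eqI[OF hd] in auto)
  with hd show ?case
    by (auto simp: differentiable_def)
qed

lemma smooth_on_cong:
  assumes "open S" "\<And>x. x \<in> S \<Longrightarrow> f x = h x" "smooth_on S f"
  shows "smooth_on S h"
  unfolding smooth_on_def
proof
  fix n
  have "cont_diff_on S f n" using assms(3) by (simp add: smooth_on_def)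
  with assms(1,2) show "cont_diff_on S h n" by (rule cont_diff_on_cong)
qed

lemma smooth_on_imp_differentiable: "smooth_on S f \<Longrightarrow> x \<in> S \<Longrightarrow> f differentiable at x"
  unfolding smooth_on_def by (auto dest: spec[of _ "Suc 0"])

lemma smooth_on_imp_continuous_on: "smooth_on S f \<Longrightarrow> continuous_on S f"
  unfolding smooth_on_def by (auto dest: spec[of _ 0])

lemma smooth_on_directional_derivative:
  "smooth_on S f \<Longrightarrow> smooth_on S (\<lambda>x. frechet_derivative f (at x) v)"
  unfolding smooth_on_def using cont_diff_on.simps(2) by blast

lemma smooth_on_has_derivative:
  "smooth_on S f \<Longrightarrow> x \<in> S \<Longrightarrow> (f has_derivative frechet_derivative f (at x)) (at x)"
  by (simp add: smooth_on_imp_differentiable frechet_derivative_works[symmetric])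

lemma has_derivative_slice:
  assumes "(F has_derivative F') (at (t, x))"
  shows "((\<lambda>y. F (t, y)) has_derivative (\<lambda>v. F' (0, v))) (at x)"
proof -
  have "(Pair t has_derivative (\<lambda>v. (0, v))) (at x)"
    by (auto intro!: derivative_eq_intros)
  from has_derivative_compose[OF this assms] show ?thesis .
qed

lemma has_vector_derivative_slice:
  assumes "(F has_derivative F') (at (t, x))"
  shows "((\<lambda>s. F (s, x)) has_vector_derivative F' (1, 0)) (at t)"
proof -
  interpret F: bounded_linear F'
    using assms by (rule has_derivative_bounded_linear)
  have "((\<lambda>s. F (s, x)) has_derivative (\<lambda>r. F' (r, 0))) (at t)"
    by (rule has_derivative_compose[where f="\<lambda>s. (s, x)", OF _ assms])
      (auto intro!: derivative_eq_intros)
  moreover have "(\<lambda>r. F' (r, 0)) = (\<lambda>r. r *\<^sub>R F' (1, 0))"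
    by (simp add: fun_eq_iff F.scaleR[symmetric])
  ultimately show ?thesis
    by (simp add: has_vector_derivative_def)
qed

text \<open>The recursion in the notion of \<open>n\<close>-fold differentiability passes to directional derivatives. The
derivative of a slice in direction \<open>v\<close> is the slice of the derivative in direction \<open>(0, v)\<close>, so the
induction stays within slices.\<close>

lemma cont_diff_on_slice:
  assumes "open T" "open U" "t \<in> T" "cont_diff_on (T \<times> U) F n"
  shows "cont_diff_on U (\<lambda>x. F (t, x)) n"
  using assms(4)
proof (induction n arbitrary: F)
  case 0
  then have "continuous_on (T \<times> U) F" by simp
  then have "continuous_on U (F \<circ> Pair t)"
    by (intro continuous_on_compose continuous_intros)
      (auto elim: continuous_on_subset simp: \<open>t \<in> T\<close>)
  then show ?case by (simp add: o_def)
next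
  case (Suc n)
  have d: "((\<lambda>y. F (t, y)) has_derivative (\<lambda>v. frechet_derivative F (at (t, x)) (0, v))) (at x)"
    if "x \<in> U" for x
    using Suc.prems that \<open>t \<in> T\<close>
    by (intro has_derivative_slice) (auto simp: frechet_derivative_works[symmetric])
  have "cont_diff_on U (\<lambda>x. frechet_derivative (\<lambda>y. F (t, y)) (at x) v) n" for v
    by (rule cont_diff_on_cong[OF \<open>open U\<close> _
          Suc.IH[of "\<lambda>p. frechet_derivative F (at p) (0, v)"]])
      (use Suc.prems frechet_derivative_eqI[OF d] in auto)
  with d show ?case
    by (auto simp: differentiable_def)
qed

lemma smooth_on_slice:
  assumes "open T" "open U" "t \<in> T" "smooth_on (T \<times> U) F"
  shows "smooth_on U (\<lambda>x. F (t, x))"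
  unfolding smooth_on_def
proof
  fix n
  have "cont_diff_on (T \<times> U) F n" using assms(4) by (simp add: smooth_on_def)
  with assms(1-3) show "cont_diff_on U (\<lambda>x. F (t, x)) n" by (rule cont_diff_on_slice)
qed

text \<open>Time derivatives are directional derivatives along \<open>(1, 0)\<close>. This identification makes the velocity
of a jointly smooth path jointly smooth again, so that it can be differentiated once more in time and
in space.\<close>

lemma time_deriv_has_vector_derivative:
  assumes "smooth_on (T \<times> U) (\<lambda>(t, x). h t c x)" "t \<in> T" "x \<in> U"
  shows "((\<lambda>s. h s c x) has_vector_derivative time_deriv h t c x) (at t)"
    and "time_deriv h t c x = frechet_derivative (\<lambda>(t, x). h t c x) (at (t, x)) (1, 0)"
proof -
  have *: "((\<lambda>s. h s c x) has_vector_derivative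
      frechet_derivative (\<lambda>(t, x). h t c x) (at (t, x)) (1, 0)) (at t)"
    using has_vector_derivative_slice[OF smooth_on_has_derivative[OF assms(1)]] assms by auto
  then show "time_deriv h t c x = frechet_derivative (\<lambda>(t, x). h t c x) (at (t, x)) (1, 0)"
    unfolding time_deriv_def by (rule vector_derivative_at)
  with * show "((\<lambda>s. h s c x) has_vector_derivative time_deriv h t c x) (at t)"
    by simp
qed

lemma smooth_on_time_deriv:
  assumes "open T" "open U" "smooth_on (T \<times> U) (\<lambda>(t, x). h t c x)"
  shows "smooth_on (T \<times> U) (\<lambda>(t, x). time_deriv h t c x)"
  by (rule smooth_on_cong[OF _ _ smooth_on_directional_derivative[OF assms(3), of "(1, 0)"]])
    (use assms time_deriv_has_vector_derivative(2)[where h=h and c=c, OF assms(3)] in \<open>auto intro: open_Times\<close>)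

text \<open>Mixed partial derivatives commute: \<open>\<phi>(a, b) - \<phi>(l, b)\<close> is, for a fixed \<open>l\<close> below \<open>a\<close>,
the integral of \<open>\<phi>a\<close> from \<open>l\<close> to \<open>a\<close>;
differentiating under the integral in \<open>b\<close> and applying the fundamental theorem of calculus in \<open>a\<close>
shows that the derivative of \<open>\<phi>b\<close> exists and equals \<open>\<phi>ab\<close>.\<close>

lemma mixed_derivative:
  fixes \<phi> :: "real \<Rightarrow> real \<Rightarrow> 'b::euclidean_space"
  assumes J: "open J" "a0 \<in> J" and L: "open L" "convex L" "b0 \<in> L"
    and da: "\<And>a b. a \<in> J \<Longrightarrow> b \<in> L \<Longrightarrow> ((\<lambda>a. \<phi> a b) has_vector_derivative \<phi>a a b) (at a)"
    and db: "\<And>a. a \<in> J \<Longrightarrow> ((\<lambda>b. \<phi> a b) has_vector_derivative \<phi>b a) (at b0)"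
    and dab: "\<And>a b. a \<in> J \<Longrightarrow> b \<in> L \<Longrightarrow> ((\<lambda>b. \<phi>a a b) has_vector_derivative \<phi>ab a b) (at b)"
    and ca: "continuous_on (J \<times> L) (\<lambda>(a, b). \<phi>a a b)"
    and cab: "continuous_on (J \<times> L) (\<lambda>(a, b). \<phi>ab a b)"
  shows "(\<phi>b has_vector_derivative \<phi>ab a0 b0) (at a0)"
proof -
  obtain e where e: "e > 0" "cball a0 e \<subseteq> J"
    using J open_contains_cball by blast
  define l where "l = a0 - e"
  define r where "r = a0 + e"
  have lr: "{l..r} \<subseteq> J" "l < a0" "a0 < r"
    using e by (auto simp: l_def r_def cball_eq_atLeastAtMost)
  have swap: "continuous_on (L \<times> {l..r}) (\<lambda>(b, a). \<psi> a b)"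
    if "continuous_on (J \<times> L) (\<lambda>(a, b). \<psi> a b)" for \<psi> :: "real \<Rightarrow> real \<Rightarrow> 'b"
  proof -
    have "continuous_on (L \<times> {l..r}) ((\<lambda>(a, b). \<psi> a b) \<circ> (\<lambda>(b, a). (a, b)))"
      by (rule continuous_on_compose)
        (use lr in \<open>auto simp: case_prod_unfold intro!: continuous_intros continuous_on_subset[OF that[unfolded case_prod_unfold]]\<close>)
    then show ?thesis by (simp add: o_def case_prod_unfold)
  qed
  have slice: "continuous_on {l..r} (\<lambda>a. \<psi> a b)"
    if "continuous_on (J \<times> L) (\<lambda>(a, b). \<psi> a b)" "b \<in> L" for \<psi> :: "real \<Rightarrow> real \<Rightarrow> 'b" and b
  proof -
    have "continuous_on {l..r} ((\<lambda>(a, b). \<psi> a b) \<circ> (\<lambda>a. (a, b)))"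
      by (intro continuous_on_compose continuous_intros)
        (use lr that in \<open>auto elim!: continuous_on_subset\<close>)
    then show ?thesis by (simp add: o_def)
  qed
  have ftc: "integral {l..a} (\<lambda>s. \<phi>a s b) = \<phi> a b - \<phi> l b" if "a \<in> {l..r}" "b \<in> L" for a b
  proof (rule integral_unique, rule fundamental_theorem_of_calculus)
    show "((\<lambda>a. \<phi> a b) has_vector_derivative \<phi>a s b) (at s within {l..a})" if "s \<in> {l..a}" for s
      by (rule has_vector_derivative_at_within, rule da)
        (use that \<open>a \<in> {l..r}\<close> \<open>b \<in> L\<close> lr in auto)
  qed (use that in auto)
  have eq: "\<phi>b a = \<phi>b l + integral {l..a} (\<lambda>s. \<phi>ab s b0)" if a: "a \<in> {l..r}" for a
  proof -
    have sub: "{l..a} \<subseteq> {l..r}" using a by auto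
    have "((\<lambda>b. integral (cbox l a) (\<lambda>s. \<phi>a s b)) has_vector_derivative
        integral (cbox l a) (\<lambda>s. \<phi>ab s b0)) (at b0 within L)"
    proof (rule leibniz_rule_vector_derivative)
      show "((\<lambda>b. \<phi>a s b) has_vector_derivative \<phi>ab s b) (at b within L)"
        if "b \<in> L" "s \<in> cbox l a" for b s
        by (rule has_vector_derivative_at_within, rule dab) (use that sub lr in auto)
      show "(\<lambda>s. \<phi>a s b) integrable_on cbox l a" if "b \<in> L" for b
        using continuous_on_subset[OF slice[OF ca that] sub]
        by (simp add: integrable_continuous_real)
      show "continuous_on (L \<times> cbox l a) (\<lambda>(b, s). \<phi>ab s b)"
        by (rule continuous_on_subset[OF swap[OF cab]]) (use sub in auto)
    qed (use L in auto)
    then have 1: "((\<lambda>b. integral {l..a} (\<lambda>s. \<phi>a s b)) has_vector_derivative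
        integral {l..a} (\<lambda>s. \<phi>ab s b0)) (at b0)"
      using at_within_open[OF L(3) L(1)] by simp
    have 2: "((\<lambda>b. \<phi> a b - \<phi> l b) has_vector_derivative \<phi>b a - \<phi>b l) (at b0)"
      using lr a by (intro has_vector_derivative_diff db) auto
    have 3: "((\<lambda>b. \<phi> a b - \<phi> l b) has_vector_derivative integral {l..a} (\<lambda>s. \<phi>ab s b0)) (at b0)"
      by (rule has_vector_derivative_transform_within_open[OF 1 L(1) L(3)]) (use ftc a in auto)
    from vector_derivative_unique_at[OF 2 3] show ?thesis
      by (simp add: algebra_simps)
  qed
  have "((\<lambda>a. integral {l..a} (\<lambda>s. \<phi>ab s b0)) has_vector_derivative \<phi>ab a0 b0)
      (at a0 within {l..r})"
    by (rule integral_has_vector_derivative) (use slice[OF cab L(3)] lr in auto)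
  then have "((\<lambda>a. integral {l..a} (\<lambda>s. \<phi>ab s b0)) has_vector_derivative \<phi>ab a0 b0) (at a0)"
    using lr by (simp add: at_within_Icc_at)
  then have "((\<lambda>a. \<phi>b l + integral {l..a} (\<lambda>s. \<phi>ab s b0)) has_vector_derivative \<phi>ab a0 b0) (at a0)"
    by (auto intro!: derivative_eq_intros)
  then show ?thesis
    by (rule has_vector_derivative_transform_within_open[where S="{l<..<r}"]) (use lr in \<open>auto intro!: eq[symmetric]\<close>)
qed

text \<open>The two variables of \<open>mixed_derivative\<close> are the time and the position on the line through \<open>x\<close> in
direction \<open>v\<close>.\<close>

lemma time_deriv_partial_commute:
  fixes h :: "real \<Rightarrow> ('a, 'm::finite, 'b::euclidean_space) field"
  assumes "open T" "open U" "smooth_on (T \<times> U) (\<lambda>(t, x). h t c x)"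
    and "t \<in> T" "x \<in> U"
  shows "((\<lambda>s. frechet_derivative (h s c) (at x) v) has_vector_derivative
    frechet_derivative (time_deriv h t c) (at x) v) (at t)"
proof -
  have op: "open (T \<times> U)" using assms by (auto intro: open_Times)
  have sm': "smooth_on (T \<times> U) (\<lambda>(t, x). time_deriv h t c x)"
    by (rule smooth_on_time_deriv) fact+
  define L where "L = {b. x + b *\<^sub>R v \<in> U}"
  have oL: "open L"
    unfolding L_def using assms(2)
    by (intro open_vimage[of U "\<lambda>b. x + b *\<^sub>R v", unfolded vimage_def] continuous_intros)
  have "0 \<in> L" using assms by (simp add: L_def)
  then obtain e where e: "e > 0" "ball 0 e \<subseteq> L"
    using oL open_contains_ball by blast
  have inU: "x + b *\<^sub>R v \<in> U" if "b \<in> ball 0 e" for b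
    using that e by (auto simp: L_def)
  have line: "((\<lambda>b. k (x + b *\<^sub>R v)) has_vector_derivative frechet_derivative k (at (x + b *\<^sub>R v)) v) (at b)"
    if "smooth_on U k" "b \<in> ball 0 e" for k :: "real^'m \<Rightarrow> 'b" and b
  proof -
    have d: "(k has_derivative frechet_derivative k (at (x + b *\<^sub>R v))) (at (x + b *\<^sub>R v))"
      by (rule smooth_on_has_derivative[OF that(1) inU[OF that(2)]])
    have "((\<lambda>b. x + b *\<^sub>R v) has_derivative (\<lambda>r. r *\<^sub>R v)) (at b)"
      by (auto intro!: derivative_eq_intros)
    from has_derivative_compose[OF this d] show ?thesis
      unfolding has_vector_derivative_def
      by (simp add: linear_scale[OF has_derivative_linear[OF d]])
  qed
  have sl: "smooth_on U (h a c)" if "a \<in> T" for a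
    using smooth_on_slice[OF assms(1,2) that assms(3)] by simp
  have sl': "smooth_on U (time_deriv h a c)" if "a \<in> T" for a
    using smooth_on_slice[OF assms(1,2) that sm'] by simp
  have cont: "continuous_on (T \<times> ball 0 e) (\<lambda>(a, b). k (a, x + b *\<^sub>R v))"
    if "continuous_on (T \<times> U) k" for k :: "real \<times> (real^'m) \<Rightarrow> 'b"
  proof -
    have "continuous_on (T \<times> ball 0 e) (k \<circ> (\<lambda>(a, b). (a, x + b *\<^sub>R v)))"
      by (rule continuous_on_compose)
        (use inU in \<open>auto simp: case_prod_unfold intro!: continuous_intros continuous_on_subset[OF that]\<close>)
    then show ?thesis by (simp add: o_def case_prod_unfold)
  qed
  have fr: "frechet_derivative (time_deriv h a c) (at y) v =
     frechet_derivative (\<lambda>(t, x). time_deriv h t c x) (at (a, y)) (0, v)" if "a \<in> T" "y \<in> U" for a y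
    using has_derivative_slice[OF smooth_on_has_derivative[OF sm', of "(a, y)"]] that
    by (auto dest!: frechet_derivative_eqI)
  have fr_cont: "continuous_on (T \<times> U) (\<lambda>(a, y). frechet_derivative (time_deriv h a c) (at y) v)"
    by (rule continuous_on_eq[OF smooth_on_imp_continuous_on[OF
          smooth_on_directional_derivative[OF sm', of "(0, v)"]]]) (use fr in auto)
  have "((\<lambda>s. frechet_derivative (h s c) (at (x + 0 *\<^sub>R v)) v) has_vector_derivative
    frechet_derivative (time_deriv h t c) (at (x + 0 *\<^sub>R v)) v) (at t)"
  proof (rule mixed_derivative[where J=T and L="ball 0 e" and \<phi>="\<lambda>a b. h a c (x + b *\<^sub>R v)"
        and \<phi>a="\<lambda>a b. time_deriv h a c (x + b *\<^sub>R v)"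
        and \<phi>ab="\<lambda>a b. frechet_derivative (time_deriv h a c) (at (x + b *\<^sub>R v)) v"])
    show "continuous_on (T \<times> ball 0 e) (\<lambda>(a, b). time_deriv h a c (x + b *\<^sub>R v))"
      using cont[OF smooth_on_imp_continuous_on[OF sm']] by simp
    show "continuous_on (T \<times> ball 0 e)
       (\<lambda>(a, b). frechet_derivative (time_deriv h a c) (at (x + b *\<^sub>R v)) v)"
      using cont[OF fr_cont] by simp
    show "((\<lambda>b. h a c (x + b *\<^sub>R v)) has_vector_derivative
          frechet_derivative (h a c) (at (x + 0 *\<^sub>R v)) v) (at 0)" if "a \<in> T" for a
      using line[OF sl[OF that], of 0] e by simp
    show "((\<lambda>a. h a c (x + b *\<^sub>R v)) has_vector_derivative time_deriv h a c (x + b *\<^sub>R v)) (at a)"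
      if "a \<in> T" "b \<in> ball 0 e" for a b
      by (rule time_deriv_has_vector_derivative(1)[where h=h and c=c, OF assms(3) that(1) inU[OF that(2)]])
  qed (use assms e line sl' in auto)
  then show ?thesis by simp
qed


section \<open>Calculus of matrix-valued functions\<close>

lemma matrix_inv_cancel:
  fixes M :: "real^'n^'n"
  assumes "det M \<noteq> 0"
  shows "matrix_inv M ** M = mat 1" "M ** matrix_inv M = mat 1"
proof -
  from assms have "invertible M" by (simp add: invertible_det_nz)
  then have "M ** matrix_inv M = mat 1 \<and> matrix_inv M ** M = mat 1"
    unfolding matrix_inv_def invertible_def by (rule someI_ex)
  then show "matrix_inv M ** M = mat 1" "M ** matrix_inv M = mat 1" by auto
qed

lemma bounded_bilinear_matrix_mult:
  "bounded_bilinear ((**) :: real^'n^'m \<Rightarrow> real^'p^'n \<Rightarrow> real^'p^'m)"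
  by (rule bilinear_conv_bounded_bilinear[THEN iffD1])
    (auto simp: bilinear_def intro!: linearI
      simp: matrix_matrix_mult_def vec_eq_iff algebra_simps sum.distrib sum_distrib_left)

lemmas matrix_mult_linear_simps =
  bounded_bilinear.add_left[OF bounded_bilinear_matrix_mult]
  bounded_bilinear.add_right[OF bounded_bilinear_matrix_mult]
  bounded_bilinear.diff_left[OF bounded_bilinear_matrix_mult]
  bounded_bilinear.diff_right[OF bounded_bilinear_matrix_mult]
  bounded_bilinear.minus_left[OF bounded_bilinear_matrix_mult]
  bounded_bilinear.minus_right[OF bounded_bilinear_matrix_mult]
  bounded_bilinear.scaleR_left[OF bounded_bilinear_matrix_mult]
  bounded_bilinear.scaleR_right[OF bounded_bilinear_matrix_mult]

lemmas has_derivative_matrix_mult =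
  bounded_bilinear.FDERIV[OF bounded_bilinear_matrix_mult]

lemmas has_vector_derivative_matrix_mult =
  bounded_bilinear.has_vector_derivative[OF bounded_bilinear_matrix_mult]

lemma bounded_linear_trace: "bounded_linear (trace :: real^'n^'n \<Rightarrow> real)"
  by (rule linear_conv_bounded_linear[THEN iffD1])
    (auto intro!: linearI simp: trace_def sum.distrib sum_distrib_left)

lemma bounded_linear_transpose: "bounded_linear (transpose :: real^'n^'m \<Rightarrow> real^'m^'n)"
  by (rule linear_conv_bounded_linear[THEN iffD1])
    (auto intro!: linearI simp: transpose_def vec_eq_iff)

lemma differentiable_vecI:
  fixes f :: "'a::real_normed_vector \<Rightarrow> 'b::euclidean_space^'n"
  assumes "\<And>i. (\<lambda>y. f y $ i) differentiable F"
  shows "f differentiable F"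
proof -
  have ax: "bounded_linear (axis i :: 'b \<Rightarrow> 'b^'n)" for i
    by (rule linear_conv_bounded_linear[THEN iffD1])
      (auto intro!: linearI simp: axis_def vec_eq_iff)
  have "f = (\<lambda>y. \<Sum>i\<in>UNIV. axis i (f y $ i))"
    by (simp add: fun_eq_iff vec_eq_iff axis_def if_distrib[where f="\<lambda>x. x $ _"] cong: if_cong)
  moreover have "(\<lambda>y. \<Sum>i\<in>UNIV. axis i (f y $ i)) differentiable F"
  proof -
    have "(\<lambda>y. axis i (f y $ i)) differentiable F" for i
      using assms[of i] bounded_linear.has_derivative[OF ax]
      unfolding differentiable_def by blast
    then show ?thesis by (intro differentiable_sum) auto
  qed
  ultimately show ?thesis by simp
qed

lemma has_derivative_entry:
  fixes M :: "'a::real_normed_vector \<Rightarrow> real^'n^'m"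
  assumes "(M has_derivative M') F"
  shows "((\<lambda>y. M y $ i $ j) has_derivative (\<lambda>h. M' h $ i $ j)) F"
  using bounded_linear.has_derivative[OF bounded_linear_vec_nth
      bounded_linear.has_derivative[OF bounded_linear_vec_nth assms]] .

text \<open>Jacobi's formula. The derivative of the Leibniz sum replaces one row of \<open>M\<close> at a time by the
corresponding row of \<open>M'\<close>. Row \<open>k\<close> of \<open>M'\<close> is the combination of the rows of \<open>M\<close> with the coefficients
in row \<open>k\<close> of \<open>M'M\<^sup>-\<^sup>1\<close>, so by Cramer's rule the new determinant is \<open>(M'M\<^sup>-\<^sup>1)\<^sub>k\<^sub>k det M\<close>.\<close>

lemma has_derivative_det:
  fixes M :: "'a::real_normed_vector \<Rightarrow> real^'n^'n"
  assumes M: "(M has_derivative M') (at x within S)" and nz: "det (M x) \<noteq> 0"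
  shows "((\<lambda>y. det (M y)) has_derivative (\<lambda>h. det (M x) * trace (matrix_inv (M x) ** M' h)))
    (at x within S)"
proof -
  let ?rep = "\<lambda>h k. (\<chi> i j. if i = k then M' h $ i $ j else M x $ i $ j) :: real^'n^'n"
  have "((\<lambda>y. det (M y)) has_derivative
    (\<lambda>h. \<Sum>p | p permutes UNIV. of_int (sign p) *
      (\<Sum>k\<in>UNIV. M' h $ k $ p k * (\<Prod>i\<in>UNIV - {k}. M x $ i $ p i)))) (at x within S)"
    unfolding det_def
    by (auto intro!: derivative_eq_intros has_derivative_entry[OF M])
  moreover have "(\<Sum>p | p permutes UNIV. of_int (sign p) *
      (\<Sum>k\<in>UNIV. M' h $ k $ p k * (\<Prod>i\<in>UNIV - {k}. M x $ i $ p i)))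
      = (\<Sum>k\<in>UNIV. det (?rep h k))" (is "?l = ?r") for h
  proof -
    have *: "(\<Prod>i\<in>UNIV. ?rep h k $ i $ p i) = M' h $ k $ p k * (\<Prod>i\<in>UNIV - {k}. M x $ i $ p i)"
      for k and p :: "'n \<Rightarrow> 'n"
      by (subst prod.remove[of _ k]) (auto intro!: prod.cong)
    have "?r = (\<Sum>k\<in>UNIV. \<Sum>p | p permutes UNIV. of_int (sign p) *
      (M' h $ k $ p k * (\<Prod>i\<in>UNIV - {k}. M x $ i $ p i)))"
      unfolding det_def * ..
    also have "\<dots> = ?l"
      by (subst sum.swap) (simp add: sum_distrib_left)
    finally show ?thesis ..
  qed
  moreover have "det (?rep h k) = (M' h ** matrix_inv (M x)) $ k $ k * det (M x)" for h k
  proof -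
    define w where "w = row k (M' h ** matrix_inv (M x))"
    have "transpose (M x) *v w = row k (M' h)"
    proof -
      have "transpose (M x) *v w = row k (M' h ** matrix_inv (M x) ** M x)"
        by (simp add: w_def vec_eq_iff matrix_vector_mult_def matrix_matrix_mult_def[of _ "M x"]
            transpose_def row_def mult.commute)
      then show ?thesis
        by (simp add: matrix_mul_assoc[symmetric] matrix_inv_cancel[OF nz])
    qed
    then have "transpose (?rep h k) =
        (\<chi> i j. if j = k then (transpose (M x) *v w) $ i else transpose (M x) $ i $ j)"
      by (simp add: transpose_def row_def vec_eq_iff)
    then have "det (transpose (?rep h k)) = w $ k * det (transpose (M x))"
      by (simp only: cramer_lemma)
    then show ?thesis
      by (simp add: det_transpose w_def row_def)
  qed
  ultimately show ?thesis
    unfolding trace_mul_sym[of "matrix_inv (M x)"]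
    by (simp add: trace_def sum_distrib_left[symmetric] sum_distrib_right[symmetric] mult.commute)
qed

text \<open>Cramer's rule writes the entries of the inverse as quotients of determinants whose entries are
those of \<open>M\<close> or constants.\<close>

lemma differentiable_matrix_inv:
  fixes M :: "'a::real_normed_vector \<Rightarrow> real^'n^'n"
  assumes M: "(M has_derivative M') (at x)" and nz: "det (M x) \<noteq> 0"
  shows "(\<lambda>y. matrix_inv (M y)) differentiable (at x)"
proof -
  let ?N = "\<lambda>y k l. (\<chi> i j. if j = k then axis l 1 $ i else M y $ i $ j) :: real^'n^'n"
  have cof: "matrix_inv (M y) $ k $ l = det (?N y k l) / det (M y)" if "det (M y) \<noteq> 0" for y k l
  proof -
    have "M y *v (matrix_inv (M y) *v axis l 1) = axis l 1"
      by (simp add: matrix_vector_mul_assoc matrix_inv_cancel[OF that])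
    then have "matrix_inv (M y) *v axis l 1 =
        (\<chi> k. det (\<chi> i j. if j = k then axis l 1 $ i else M y $ i $ j) / det (M y))"
      using cramer[OF that] by blast
    moreover have "(matrix_inv (M y) *v axis l 1) $ k = matrix_inv (M y) $ k $ l"
      by (simp add: matrix_vector_mul_component inner_axis)
    ultimately show ?thesis by simp
  qed
  have dd: "(\<lambda>y. det (M y)) differentiable (at x)"
    using has_derivative_det[OF M nz] by (auto simp: differentiable_def)
  have "isCont (\<lambda>y. det (M y)) x"
    using dd by (rule differentiable_imp_continuous_within)
  then have ev: "eventually (\<lambda>y. det (M y) \<noteq> 0) (nhds x)"
    using nz tendsto_imp_eventually_ne[of "\<lambda>y. det (M y)" "det (M x)" "nhds x" 0]
    by (simp add: continuous_within tendsto_nhds_iff)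
  then obtain S where S: "open S" "x \<in> S" "\<And>y. y \<in> S \<Longrightarrow> det (M y) \<noteq> 0"
    unfolding eventually_nhds by blast
  have "(\<lambda>y. matrix_inv (M y) $ k $ l) differentiable (at x)" for k l
  proof -
    have e: "(\<lambda>y. ?N y k l $ i $ j) differentiable (at x)" for i j
      using has_derivative_entry[OF M, of i j] by (cases "j = k") (auto simp: differentiable_def)
    have "(\<lambda>y. \<Prod>i\<in>UNIV. ?N y k l $ i $ p i) differentiable (at x)" for p
      unfolding differentiable_def
      by (rule exI, rule has_derivative_prod) (rule e[unfolded frechet_derivative_works])
    then have "(\<lambda>y. det (?N y k l)) differentiable (at x)"
      unfolding det_def by (intro differentiable_sum) (auto intro!: derivative_intros)
    then have "(\<lambda>y. det (?N y k l) / det (M y)) differentiable (at x)"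
      using dd nz by (rule differentiable_divide)
    then obtain D where D: "((\<lambda>y. det (?N y k l) / det (M y)) has_derivative D) (at x)"
      by (auto simp: differentiable_def)
    have "((\<lambda>y. matrix_inv (M y) $ k $ l) has_derivative D) (at x)"
      by (rule has_derivative_transform_within_open[OF D S(1,2)]) (simp only: cof[OF S(3)])
    then show ?thesis
      by (auto simp: differentiable_def)
  qed
  then show ?thesis by (intro differentiable_vecI)
qed

text \<open>Once the inverse is known to be differentiable, differentiating \<open>M\<^sup>-\<^sup>1M = 1\<close> yields the formula.\<close>

lemma has_derivative_matrix_inv:
  fixes M :: "'a::real_normed_vector \<Rightarrow> real^'n^'n"
  assumes S: "open S" "x \<in> S" and nz: "\<And>y. y \<in> S \<Longrightarrow> det (M y) \<noteq> 0"
    and M: "(M has_derivative M') (at x)"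
  shows "((\<lambda>y. matrix_inv (M y)) has_derivative
    (\<lambda>h. - (matrix_inv (M x) ** M' h ** matrix_inv (M x)))) (at x)"
proof -
  obtain N' where N: "((\<lambda>y. matrix_inv (M y)) has_derivative N') (at x)"
    using differentiable_matrix_inv[OF M nz[OF S(2)]] by (auto simp: differentiable_def)
  have "((\<lambda>y. mat 1 :: real^'n^'n) has_derivative
      (\<lambda>h. matrix_inv (M x) ** M' h + N' h ** M x)) (at x)"
    by (rule has_derivative_transform_within_open[OF has_derivative_matrix_mult[OF N M] S])
      (simp add: matrix_inv_cancel nz)
  then have z: "matrix_inv (M x) ** M' h + N' h ** M x = 0" for h
    by (rule fun_cong[OF has_derivative_unique[OF _ has_derivative_const]])
  have "N' h = - (matrix_inv (M x) ** M' h ** matrix_inv (M x))" for h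
  proof -
    have "0 = (matrix_inv (M x) ** M' h + N' h ** M x) ** matrix_inv (M x)"
      by (simp add: z)
    also have "\<dots> = matrix_inv (M x) ** M' h ** matrix_inv (M x) + N' h"
      by (simp add: matrix_mult_linear_simps matrix_mul_assoc[symmetric] matrix_inv_cancel[OF nz[OF S(2)]])
    finally show ?thesis by (simp add: eq_neg_iff_add_eq_0 add.commute)
  qed
  then have "N' = (\<lambda>h. - (matrix_inv (M x) ** M' h ** matrix_inv (M x)))" by auto
  with N show ?thesis by simp
qed


section \<open>Christoffel symbols and the divergence of a symmetric endomorphism\<close>

text \<open>Along the segment from the identity to \<open>M\<close> all matrices are positive definite, hence invertible, so
the determinant cannot change sign.\<close>

lemma positive_definite_imp_det_pos:
  fixes M :: "real^'n^'n"
  assumes pd: "\<And>\<xi>. \<xi> \<noteq> 0 \<Longrightarrow> \<xi> \<bullet> (M *v \<xi>) > 0"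
  shows "det M > 0"
proof (rule ccontr)
  assume "\<not> det M > 0"
  define p where "p = (\<lambda>t::real. det ((1 - t) *\<^sub>R mat 1 + t *\<^sub>R M))"
  have "continuous_on {0..1} p"
    unfolding p_def det_def by (intro continuous_intros)
  moreover have "p 0 = 1" "p 1 \<le> 0"
    using \<open>\<not> det M > 0\<close> by (simp_all add: p_def)
  ultimately obtain t where t: "0 \<le> t" "t \<le> 1" "p t = 0"
    using IVT2'[of p 1 0 0] by auto
  then have "\<not> invertible ((1 - t) *\<^sub>R mat 1 + t *\<^sub>R M)"
    by (simp add: p_def invertible_det_nz)
  then obtain \<xi> where \<xi>: "\<xi> \<noteq> 0" "((1 - t) *\<^sub>R mat 1 + t *\<^sub>R M) *v \<xi> = 0"
    using matrix_left_invertible_ker invertible_left_inverse by blast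
  then have "0 = \<xi> \<bullet> (((1 - t) *\<^sub>R mat 1 + t *\<^sub>R M) *v \<xi>)" by simp
  also have "\<dots> = (1 - t) * (\<xi> \<bullet> \<xi>) + t * (\<xi> \<bullet> (M *v \<xi>))"
    by (simp add: matrix_vector_mult_add_rdistrib scaleR_matrix_vector_assoc[symmetric] inner_add_right)
  also have "\<dots> > 0"
  proof (cases "t = 0")
    case True
    then show ?thesis using \<xi> by simp
  next
    case False
    have "(1 - t) * (\<xi> \<bullet> \<xi>) \<ge> 0" using t by simp
    moreover have "t * (\<xi> \<bullet> (M *v \<xi>)) > 0" using t False pd[OF \<xi>(1)] by simp
    ultimately show ?thesis by linarith
  qed
  finally show False by simp
qed

lemma transpose_matrix_inv:
  fixes M :: "real^'n^'n"
  assumes "det M \<noteq> 0" "transpose M = M"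
  shows "transpose (matrix_inv M) = matrix_inv M"
proof -
  have "transpose (matrix_inv M) = transpose (matrix_inv M) ** (M ** matrix_inv M)"
    by (simp add: matrix_inv_cancel assms)
  also have "\<dots> = transpose (M ** matrix_inv M) ** matrix_inv M"
    by (simp add: matrix_transpose_mul assms matrix_mul_assoc)
  finally show ?thesis by (simp add: matrix_inv_cancel assms)
qed

lemma symmetric_matrix_entry:
  fixes M :: "real^'n^'n"
  assumes "transpose M = M"
  shows "M $ i $ j = M $ j $ i"
proof -
  have "M $ i $ j = transpose M $ j $ i" by (simp add: transpose_def)
  then show ?thesis by (simp only: assms)
qed

text \<open>The Christoffel symbols of the first kind: if \<open>dg k\<close> is the matrix \<open>\<partial>\<^sub>kg\<close>, then the entry \<open>(l, j)\<close> of
\<open>christoffel_first_kind dg k\<close> is \<open>\<Gamma>\<^sub>l\<^sub>,\<^sub>k\<^sub>j\<close>. Grouping the symbols by the direction of differentiation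
turns the connection form in direction \<open>k\<close> into a matrix product.\<close>

definition christoffel_first_kind :: "('m \<Rightarrow> real^'m^'m) \<Rightarrow> 'm \<Rightarrow> real^'m^'m" where
  "christoffel_first_kind dg k = (\<chi> l j. 1/2 * (dg k $ l $ j + dg j $ l $ k - dg l $ k $ j))"

text \<open>This is metric compatibility: \<open>\<partial>\<^sub>kg\<^sub>l\<^sub>j = \<Gamma>\<^sub>l\<^sub>,\<^sub>k\<^sub>j + \<Gamma>\<^sub>j\<^sub>,\<^sub>k\<^sub>l\<close>.\<close>

lemma christoffel_first_kind_add_transpose:
  assumes "\<And>k. transpose (dg k) = dg k"
  shows "christoffel_first_kind dg k + transpose (christoffel_first_kind dg k) = dg k"
proof -
  have "dg k $ i $ j = dg k $ j $ i" for k i j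
    by (rule symmetric_matrix_entry[OF assms])
  then show ?thesis
    by (auto simp: christoffel_first_kind_def transpose_def vec_eq_iff field_simps)
qed

text \<open>In the contraction with a symmetric matrix, the part of the symbols that is antisymmetric in \<open>k\<close>
and \<open>l\<close> drops out. The case \<open>F = g\<^sup>-\<^sup>1\<close> is \<open>\<Gamma>\<^sup>k\<^sub>k\<^sub>j = \<partial>\<^sub>j log \<surd>(det g)\<close>.\<close>

lemma christoffel_first_kind_contract:
  fixes F :: "real^'m^'m"
  assumes "transpose F = F"
  shows "(\<Sum>k\<in>UNIV. (F ** christoffel_first_kind dg k) $ k $ j) = 1/2 * trace (F ** dg j)"
proof -
  have F: "F $ k $ a = F $ a $ k" for k a
    by (rule symmetric_matrix_entry[OF assms])
  have sw: "(\<Sum>k\<in>UNIV. \<Sum>a\<in>UNIV. F $ k $ a * dg k $ a $ j)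
      = (\<Sum>k\<in>UNIV. \<Sum>a\<in>UNIV. F $ k $ a * dg a $ k $ j)"
    by (subst sum.swap) (simp add: F)
  have "(\<Sum>k\<in>UNIV. (F ** christoffel_first_kind dg k) $ k $ j)
    = 1/2 * ((\<Sum>k\<in>UNIV. \<Sum>a\<in>UNIV. F $ k $ a * dg k $ a $ j)
        + (\<Sum>k\<in>UNIV. \<Sum>a\<in>UNIV. F $ k $ a * dg j $ a $ k)
        - (\<Sum>k\<in>UNIV. \<Sum>a\<in>UNIV. F $ k $ a * dg a $ k $ j))"
    unfolding sum.distrib[symmetric] sum_subtractf[symmetric] sum_distrib_left
    by (simp add: matrix_matrix_mult_def christoffel_first_kind_def algebra_simps)
  then show ?thesis
    by (simp add: sw trace_def matrix_matrix_mult_def)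
qed

lemma connection_form_eq:
  fixes g :: "('a, 'm::finite) matrix_field"
  assumes "g c differentiable at x"
  shows "connection_form g c x (axis k 1) = matrix_inv (g c x) **
    christoffel_first_kind (\<lambda>k. partial_deriv k (g c) x) k"
proof -
  have "partial_deriv k (\<lambda>y. g c y $ l $ j) x = partial_deriv k (g c) x $ l $ j" for k l j
    unfolding partial_deriv_def
    using frechet_derivative_eqI[OF has_derivative_entry[OF assms[unfolded frechet_derivative_works]]]
    by simp
  then have "christoffel g c x i k j = (matrix_inv (g c x) **
    christoffel_first_kind (\<lambda>k. partial_deriv k (g c) x) k) $ i $ j" for i k j
    by (simp add: christoffel_def christoffel_first_kind_def matrix_matrix_mult_def sum_distrib_left
        sum_divide_distrib)
  then show ?thesis
    by (simp add: connection_form_def vec_eq_iff axis_def if_distrib[where f="\<lambda>x. x * _"] cong: if_cong)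
qed

text \<open>The divergence of a symmetric endomorphism at a point, with the derivatives of \<open>g\<close> and \<open>v\<close> replaced
by arbitrary symmetric matrices \<open>dg k\<close> and \<open>dv k\<close>. The matrix \<open>M k\<close> is the covariant derivative of
\<open>E = g\<^sup>-\<^sup>1v\<close> in direction \<open>k\<close>. Metric compatibility makes \<open>g (M k)\<close> symmetric, and this symmetry turns
the trace over an orthonormal frame into the contraction \<open>\<nabla>\<^sub>kE\<^sup>k\<^sub>j\<close>. In that contraction both
Christoffel terms are contractions with the symmetric matrices \<open>g\<^sup>-\<^sup>1\<close> and \<open>Eg\<^sup>-\<^sup>1\<close>.\<close>

lemma divergence_algebra:
  fixes g v :: "real^'m^'m"
  assumes nz: "det g \<noteq> 0" and sym: "transpose g = g" "transpose v = v"
    "\<And>k. transpose (dg k) = dg k" "\<And>k. transpose (dv k) = dv k"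
  defines "Gi \<equiv> matrix_inv g"
  defines "E \<equiv> Gi ** v"
  defines "dE \<equiv> \<lambda>k. Gi ** dv k - Gi ** dg k ** E"
  defines "C \<equiv> \<lambda>k. Gi ** christoffel_first_kind dg k"
  defines "M \<equiv> \<lambda>k. dE k + C k ** E - E ** C k"
  shows "(g *v (\<Sum>k\<in>UNIV. \<Sum>l\<in>UNIV. Gi $ k $ l *\<^sub>R (M k *v axis l 1))) $ j =
    (\<Sum>k\<in>UNIV. dE k $ k $ j) + 1/2 * (\<Sum>l\<in>UNIV. trace (Gi ** dg l) * E $ l $ j)
      - 1/2 * trace (Gi ** dg j ** E)"
proof -
  let ?B = "christoffel_first_kind dg"
  have inv: "g ** Gi = mat 1" "Gi ** g = mat 1"
    unfolding Gi_def by (rule matrix_inv_cancel[OF nz])+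
  have gc: "g ** (Gi ** N) = N" for N :: "real^'m^'m" by (simp add: matrix_mul_assoc inv)
  have Gs: "transpose Gi = Gi" unfolding Gi_def by (rule transpose_matrix_inv[OF nz sym(1)])
  \<comment> \<open>The last two terms are transposes of each other, so this form shows the symmetry.\<close>
  have gM: "g ** M k = dv k - transpose (?B k) ** Gi ** v - v ** Gi ** ?B k" for k
  proof -
    have dgk: "dg k = ?B k + transpose (?B k)"
      by (rule christoffel_first_kind_add_transpose[OF sym(3), symmetric])
    have "g ** M k = dv k - dg k ** E + ?B k ** E - v ** (Gi ** ?B k)"
      unfolding M_def dE_def C_def E_def
      by (simp add: matrix_mult_linear_simps matrix_mul_assoc[symmetric] gc)
    also have "\<dots> = dv k - transpose (?B k) ** E - v ** (Gi ** ?B k)"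
      by (subst dgk) (simp add: matrix_mult_linear_simps)
    finally show ?thesis by (simp add: E_def matrix_mul_assoc)
  qed
  have "transpose (g ** M k) = g ** M k" for k
    unfolding gM
    by (simp add: linear_diff[OF bounded_linear.linear[OF bounded_linear_transpose]] matrix_transpose_mul sym Gs matrix_mul_assoc)
  then have gMs: "(g ** M k) $ a $ b = (g ** M k) $ b $ a" for k a b
    by (rule symmetric_matrix_entry)
  have "(g *v column l (M k)) $ j = (g ** M k) $ j $ l" for k l
    by (simp add: matrix_vector_mult_def matrix_matrix_mult_def column_def)
  then have "(g *v (\<Sum>k\<in>UNIV. \<Sum>l\<in>UNIV. Gi $ k $ l *\<^sub>R (M k *v axis l 1))) $ j
    = (\<Sum>k\<in>UNIV. \<Sum>l\<in>UNIV. Gi $ k $ l * (g ** M k) $ j $ l)"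
    by (simp add: linear_sum[OF matrix_vector_mul_linear] linear_scale[OF matrix_vector_mul_linear]
        matrix_vector_mult_basis)
  also have "\<dots> = (\<Sum>k\<in>UNIV. (Gi ** (g ** M k)) $ k $ j)"
    by (simp add: gMs[of _ j] matrix_matrix_mult_def[of Gi])
  also have "\<dots> = (\<Sum>k\<in>UNIV. M k $ k $ j)"
    by (simp add: matrix_mul_assoc inv)
  also have "\<dots> = (\<Sum>k\<in>UNIV. dE k $ k $ j) + (\<Sum>k\<in>UNIV. (C k ** E) $ k $ j)
      - (\<Sum>k\<in>UNIV. (E ** C k) $ k $ j)"
    by (simp add: M_def sum.distrib sum_subtractf)
  also have "(\<Sum>k\<in>UNIV. (C k ** E) $ k $ j) = 1/2 * (\<Sum>l\<in>UNIV. trace (Gi ** dg l) * E $ l $ j)"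
  proof -
    have "(\<Sum>k\<in>UNIV. (C k ** E) $ k $ j) = (\<Sum>l\<in>UNIV. (\<Sum>k\<in>UNIV. C k $ k $ l) * E $ l $ j)"
      unfolding sum_distrib_right by (subst sum.swap) (simp add: matrix_matrix_mult_def)
    then show ?thesis
      by (simp add: C_def christoffel_first_kind_contract[OF Gs] sum_divide_distrib)
  qed
  also have "(\<Sum>k\<in>UNIV. (E ** C k) $ k $ j) = 1/2 * trace (Gi ** dg j ** E)"
  proof -
    have s: "transpose (E ** Gi) = E ** Gi"
      by (simp add: E_def matrix_transpose_mul Gs sym matrix_mul_assoc)
    have "trace (E ** Gi ** dg j) = trace (Gi ** dg j ** E)"
      by (metis trace_mul_sym matrix_mul_assoc)
    with christoffel_first_kind_contract[OF s, of dg j] show ?thesis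
      by (simp add: C_def matrix_mul_assoc)
  qed
  finally show ?thesis .
qed


section \<open>The defining equation of \<open>F\<close> in coordinates\<close>

lemma has_derivative_symmetric_matrix:
  fixes M :: "'a::real_normed_vector \<Rightarrow> real^'n^'n"
  assumes "open S" "x \<in> S" "\<And>y. y \<in> S \<Longrightarrow> transpose (M y) = M y"
    and M: "(M has_derivative M') (at x)"
  shows "transpose (M' h) = M' h"
proof -
  have "((\<lambda>y. transpose (M y)) has_derivative (\<lambda>h. transpose (M' h))) (at x)"
    by (rule bounded_linear.has_derivative[OF bounded_linear_transpose M])
  then have "(M has_derivative (\<lambda>h. transpose (M' h))) (at x)"
    by (rule has_derivative_transform_within_open) (use assms in auto)
  then show ?thesis
    using has_derivative_unique[OF M] by (metis (no_types))
qed

lemma has_derivative_endo: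
  assumes "open S" "x \<in> S" "\<And>y. y \<in> S \<Longrightarrow> det (g c y) \<noteq> 0"
    and g: "(g c has_derivative g') (at x)" and v: "(v c has_derivative v') (at x)"
  shows "(endo g v c has_derivative
    (\<lambda>h. matrix_inv (g c x) ** v' h - matrix_inv (g c x) ** g' h ** endo g v c x)) (at x)"
  using has_derivative_matrix_mult[OF has_derivative_matrix_inv[OF assms(1-3) g] v]
  by (simp add: endo_def[abs_def] matrix_mult_linear_simps matrix_mul_assoc)

lemma has_derivative_log_density:
  assumes S: "open S" "x \<in> S"
    and pos: "\<And>y. y \<in> S \<Longrightarrow> det (g c y) > 0" "\<And>y. y \<in> S \<Longrightarrow> \<Omega> c y > 0"
    and g: "(g c has_derivative g') (at x)" and w: "(\<Omega> c has_derivative w') (at x)"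
  shows "((\<lambda>y. ln (metric_volume g c y / \<Omega> c y)) has_derivative
    (\<lambda>h. 1/2 * trace (matrix_inv (g c x) ** g' h) - w' h / \<Omega> c x)) (at x)"
proof -
  have "((\<lambda>y. 1/2 * ln (det (g c y)) - ln (\<Omega> c y)) has_derivative
    (\<lambda>h. 1/2 * (det (g c x) * trace (matrix_inv (g c x) ** g' h) / det (g c x)) - w' h / \<Omega> c x)) (at x)"
    using pos(1)[OF S(2)] pos(2)[OF S(2)]
    by (intro has_derivative_diff has_derivative_mult_right
        has_derivative_ln[THEN has_derivative_eq_rhs] has_derivative_det[OF g] w)
      (auto simp: divide_inverse intro!: has_derivative_det[OF g] w)
  then have "((\<lambda>y. 1/2 * ln (det (g c y)) - ln (\<Omega> c y)) has_derivative
    (\<lambda>h. 1/2 * trace (matrix_inv (g c x) ** g' h) - w' h / \<Omega> c x)) (at x)"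
    using pos(1)[OF S(2)] by simp
  then show ?thesis
    by (rule has_derivative_transform_within_open[OF _ S])
      (use pos in \<open>simp add: metric_volume_def ln_divide_pos ln_sqrt less_imp_le\<close>)
qed

text \<open>The covector obtained by lowering the index of \<open>\<nabla>\<^sup>*E + \<nabla>f\<close>, where \<open>E = g\<^sup>-\<^sup>1v\<close> and
\<open>f = V/\<Omega>\<close>, multiplied by the density \<open>\<Omega>\<close>. The
volume of \<open>g\<close> contributes \<open>1/2 Tr(g\<^sup>-\<^sup>1\<partial>\<^sub>ig)\<close> to the gradient of \<open>log(dV\<^sub>g/\<Omega>)\<close>, which cancels the trace of the
connection form in the divergence. What remains of \<open>log \<Omega>\<close> combines with the divergence of \<open>E\<close> to the
plain coordinate divergence of \<open>\<Omega>E\<close>.\<close>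

lemma F_condition_coordinates:
  fixes g v :: "('a, 'm::finite) matrix_field" and \<Omega> V :: "('a, 'm) scalar_field"
  assumes S: "open S" "x \<in> S"
    and sym: "\<And>y. y \<in> S \<Longrightarrow> transpose (g c y) = g c y" "\<And>y. y \<in> S \<Longrightarrow> transpose (v c y) = v c y"
    and pos: "\<And>y. y \<in> S \<Longrightarrow> det (g c y) > 0" "\<And>y. y \<in> S \<Longrightarrow> \<Omega> c y > 0"
    and diff: "g c differentiable at x" "v c differentiable at x"
      "\<Omega> c differentiable at x" "V c differentiable at x"
  shows "\<Omega> c x * (g c x *v (nabla_adjoint g \<Omega> (endo g v) c x + grad g (form_quotient \<Omega> V) c x)) $ j =
    - (\<Sum>k\<in>UNIV. partial_deriv k (\<lambda>y. \<Omega> c y *\<^sub>R endo g v c y) x $ k $ j)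
    + 1/2 * trace (matrix_inv (g c x) ** partial_deriv j (g c) x ** (\<Omega> c x *\<^sub>R endo g v c x))
    + (partial_deriv j (V c) x - form_quotient \<Omega> V c x * partial_deriv j (\<Omega> c) x)"
proof -
  define Gi where "Gi = matrix_inv (g c x)"
  define E where "E = endo g v c x"
  define dg where "dg = (\<lambda>k. partial_deriv k (g c) x)"
  define dv where "dv = (\<lambda>k. partial_deriv k (v c) x)"
  define dw where "dw = (\<lambda>k. partial_deriv k (\<Omega> c) x)"
  define dE where "dE = (\<lambda>k. Gi ** dv k - Gi ** dg k ** E)"
  define C where "C = (\<lambda>k. Gi ** christoffel_first_kind dg k)"
  define L where "L = (\<lambda>i. 1/2 * trace (Gi ** dg i) - dw i / \<Omega> c x)"
  note D = diff[unfolded frechet_derivative_works]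
  have nz: "\<And>y. y \<in> S \<Longrightarrow> det (g c y) \<noteq> 0" using pos by (metis less_irrefl)
  have wpos: "\<Omega> c x > 0" using pos S by blast
  note inv = matrix_inv_cancel[OF nz[OF S(2)]]
  note DE = has_derivative_endo[where g=g and v=v and c=c, OF S nz D(1,2)]
  have dE: "partial_deriv k (endo g v c) x = dE k" for k
    unfolding partial_deriv_def by (subst frechet_derivative_eqI[OF DE])
      (simp_all add: dE_def Gi_def dv_def dg_def partial_deriv_def E_def)
  have symx: "transpose (g c x) = g c x" "transpose (v c x) = v c x" using sym S by auto
  have Gs: "transpose Gi = Gi"
    unfolding Gi_def by (rule transpose_matrix_inv[OF nz[OF S(2)] symx(1)])
  have dgs: "transpose (dg k) = dg k" "transpose (dv k) = dv k" for k
    unfolding dg_def dv_def partial_deriv_def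
    using has_derivative_symmetric_matrix[OF S sym(1) D(1)]
      has_derivative_symmetric_matrix[OF S sym(2) D(2)] by auto
  have Ev: "E = Gi ** v c x" by (simp add: E_def Gi_def endo_def)
  have cov: "cov_deriv g (endo g v) c x (axis k 1) = dE k + C k ** E - E ** C k" for k
    unfolding cov_deriv_def connection_form_eq[where g=g and c=c, OF diff(1)]
    using dE by (simp add: partial_deriv_def C_def Gi_def E_def dg_def)
  have L: "partial_deriv i (\<lambda>y. ln (metric_volume g c y / \<Omega> c y)) x = L i" for i
    unfolding partial_deriv_def
    by (subst frechet_derivative_eqI[OF has_derivative_log_density[where g=g and \<Omega>=\<Omega> and c=c, OF S pos D(1,3)]])
      (simp_all add: L_def Gi_def dg_def dw_def partial_deriv_def)
  have "g c x *v (E *v grad g (\<lambda>d y. ln (metric_volume g d y / \<Omega> d y)) c x)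
      = transpose E *v (\<chi> i. L i)"
  proof -
    have "g c x ** (E ** Gi) = transpose E"
      by (simp add: Ev matrix_transpose_mul Gs[unfolded Gi_def] symx matrix_mul_assoc Gi_def inv)
    then show ?thesis
      by (simp add: grad_def L matrix_vector_mul_assoc Gi_def[symmetric])
  qed
  then have t2: "(g c x *v (E *v grad g (\<lambda>d y. ln (metric_volume g d y / \<Omega> d y)) c x)) $ j
      = (\<Sum>i\<in>UNIV. E $ i $ j * L i)"
    by (simp add: matrix_vector_mult_def transpose_def)
  have t1: "(g c x *v (\<Sum>k\<in>UNIV. \<Sum>l\<in>UNIV. Gi $ k $ l *\<^sub>R
        (cov_deriv g (endo g v) c x (axis k 1) *v axis l 1))) $ j
     = (\<Sum>k\<in>UNIV. dE k $ k $ j) + 1/2 * (\<Sum>l\<in>UNIV. trace (Gi ** dg l) * E $ l $ j)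
      - 1/2 * trace (Gi ** dg j ** E)"
    unfolding cov
    using divergence_algebra[of "g c x" "v c x" dg dv j, OF nz[OF S(2)] symx dgs]
    by (simp add: Gi_def[symmetric] Ev[symmetric] dE_def C_def)
  have t3: "(g c x *v grad g (form_quotient \<Omega> V) c x) $ j =
      (partial_deriv j (V c) x - form_quotient \<Omega> V c x * dw j) / \<Omega> c x"
  proof -
    have "((\<lambda>y. V c y / \<Omega> c y) has_derivative
       (\<lambda>h. (frechet_derivative (V c) (at x) h
          - V c x / \<Omega> c x * frechet_derivative (\<Omega> c) (at x) h) / \<Omega> c x)) (at x)"
      apply (rule derivative_eq_intros D refl)+
      using wpos by (auto simp: field_simps)
    then have "partial_deriv j (form_quotient \<Omega> V c) x =
      (partial_deriv j (V c) x - form_quotient \<Omega> V c x * dw j) / \<Omega> c x"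
      unfolding partial_deriv_def form_quotient_def[abs_def]
      by (subst frechet_derivative_eqI) (auto simp: dw_def partial_deriv_def)
    then show ?thesis
      by (simp add: grad_def matrix_vector_mul_assoc inv)
  qed
  have "((\<lambda>y. \<Omega> c y *\<^sub>R endo g v c y) has_derivative
     (\<lambda>h. \<Omega> c x *\<^sub>R (matrix_inv (g c x) ** frechet_derivative (v c) (at x) h
       - matrix_inv (g c x) ** frechet_derivative (g c) (at x) h ** endo g v c x)
       + frechet_derivative (\<Omega> c) (at x) h *\<^sub>R endo g v c x)) (at x)"
    using has_derivative_scaleR[OF D(3) DE] by simp
  then have dP: "partial_deriv k (\<lambda>y. \<Omega> c y *\<^sub>R endo g v c y) x = \<Omega> c x *\<^sub>R dE k + dw k *\<^sub>R E" for k
    unfolding partial_deriv_def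
    by (subst frechet_derivative_eqI) (auto simp: dE_def dw_def dg_def dv_def Gi_def E_def partial_deriv_def)
  have "(g c x *v (nabla_adjoint g \<Omega> (endo g v) c x + grad g (form_quotient \<Omega> V) c x)) $ j
     = - ((\<Sum>k\<in>UNIV. dE k $ k $ j) + 1/2 * (\<Sum>l\<in>UNIV. trace (Gi ** dg l) * E $ l $ j)
      - 1/2 * trace (Gi ** dg j ** E)) + (\<Sum>i\<in>UNIV. E $ i $ j * L i)
      + (partial_deriv j (V c) x - form_quotient \<Omega> V c x * dw j) / \<Omega> c x"
    unfolding nabla_adjoint_def matrix_vector_right_distrib vector_add_component t3
      linear_neg[OF matrix_vector_mul_linear] vector_uminus_component Gi_def[symmetric] E_def[symmetric] t1 t2
    by simp
  also have "(\<Sum>i\<in>UNIV. E $ i $ j * L i) = 1/2 * (\<Sum>l\<in>UNIV. trace (Gi ** dg l) * E $ l $ j)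
      - (\<Sum>i\<in>UNIV. dw i * E $ i $ j) / \<Omega> c x"
    by (simp add: L_def sum_distrib_left sum_divide_distrib sum_subtractf[symmetric] algebra_simps)
  finally have N: "(g c x *v (nabla_adjoint g \<Omega> (endo g v) c x + grad g (form_quotient \<Omega> V) c x)) $ j
     = - (\<Sum>k\<in>UNIV. dE k $ k $ j) + 1/2 * trace (Gi ** dg j ** E)
       - (\<Sum>i\<in>UNIV. dw i * E $ i $ j) / \<Omega> c x
       + (partial_deriv j (V c) x - form_quotient \<Omega> V c x * dw j) / \<Omega> c x"
    by simp
  have "(\<Sum>k\<in>UNIV. partial_deriv k (\<lambda>y. \<Omega> c y *\<^sub>R endo g v c y) x $ k $ j)
      = \<Omega> c x * (\<Sum>k\<in>UNIV. dE k $ k $ j) + (\<Sum>i\<in>UNIV. dw i * E $ i $ j)"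
    by (simp add: dP sum.distrib sum_distrib_left)
  moreover have "trace (matrix_inv (g c x) ** partial_deriv j (g c) x ** (\<Omega> c x *\<^sub>R endo g v c x))
      = \<Omega> c x * trace (Gi ** dg j ** E)"
    by (simp add: matrix_mult_linear_simps Gi_def E_def dg_def
        linear_scale[OF bounded_linear.linear[OF bounded_linear_trace]])
  ultimately show ?thesis
    unfolding N using wpos
    by (simp add: distrib_left right_diff_distrib diff_divide_distrib dw_def)
qed


section \<open>Conservation along geodesics\<close>

lemma has_vector_derivative_matrix_inv:
  fixes M :: "real \<Rightarrow> real^'n^'n"
  assumes "open T" "t \<in> T" "\<And>s. s \<in> T \<Longrightarrow> det (M s) \<noteq> 0" "(M has_vector_derivative M') (at t)"
  shows "((\<lambda>s. matrix_inv (M s)) has_vector_derivative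
    - (matrix_inv (M t) ** M' ** matrix_inv (M t))) (at t)"
  using has_derivative_matrix_inv[OF assms(1-3) assms(4)[unfolded has_vector_derivative_def]]
  by (simp add: has_vector_derivative_def matrix_mult_linear_simps)

lemma has_vector_derivative_zero_unique:
  fixes f :: "real \<Rightarrow> 'b::real_normed_vector"
  assumes "convex T" "\<And>t. t \<in> T \<Longrightarrow> (f has_vector_derivative 0) (at t)" "s \<in> T" "t \<in> T"
  shows "f s = f t"
  by (rule has_derivative_zero_unique[OF assms(1) _ assms(3,4)])
    (use assms(2) in \<open>auto simp: has_vector_derivative_def intro: has_derivative_at_withinI\<close>)

lemma partial_deriv_eqI:
  "(f has_derivative f') (at x) \<Longrightarrow> partial_deriv j f x = f' (axis j 1)"
  unfolding partial_deriv_def by (simp add: frechet_derivative_eqI)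

lemma has_derivative_partial_deriv_cong:
  assumes "open U" "x \<in> U" "\<And>y. y \<in> U \<Longrightarrow> f y = h y" "(f has_derivative f') (at x)"
  shows "partial_deriv j h x = f' (axis j 1)"
  by (rule partial_deriv_eqI, rule has_derivative_transform_within_open[OF assms(4,1,2)])
    (rule assms(3))

lemma smooth_on_field_slice:
  fixes h :: "real \<Rightarrow> ('a, 'm::finite, 'b::real_normed_vector) field"
  assumes "smooth_on (T \<times> U) (\<lambda>(t, y). h t c y)" "open T" "open U" "t \<in> T"
  shows "smooth_on U (h t c)"
  using smooth_on_slice[OF assms(2-4,1)] by simp

lemma has_derivative_field_slice:
  fixes h :: "real \<Rightarrow> ('a, 'm::finite, 'b::real_normed_vector) field"
  assumes "open T" "open U" "x \<in> U" "smooth_on (T \<times> U) (\<lambda>(t, y). h t c y)" "t \<in> T"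
  shows "(h t c has_derivative frechet_derivative (h t c) (at x)) (at x)"
  by (rule smooth_on_has_derivative[OF smooth_on_field_slice[where h=h, OF assms(4,1,2,5)] assms(3)])

text \<open>The density \<open>\<Omega> (g (\<nabla>\<^sup>*E + \<nabla>f))\<^sub>j\<close> at a fixed point of a chart is constant along solutions of the two
equations, for any function \<open>\<kappa>\<close> of time in the second one: \<open>\<kappa>\<close> disappears under a derivative in space.\<close>

lemma F_condition_conserved:
  fixes g :: "real \<Rightarrow> ('a, 'm::finite) matrix_field" and \<Omega> :: "real \<Rightarrow> ('a, 'm) scalar_field"
    and \<kappa> :: "real \<Rightarrow> real" and j :: 'm
  defines "E \<equiv> \<lambda>t. endo (g t) (time_deriv g t)"
    and "f \<equiv> \<lambda>t. form_quotient (\<Omega> t) (time_deriv \<Omega> t)"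
  assumes T: "open T" "convex T" and U: "open U" "x \<in> U"
    and smooth: "smooth_on (T \<times> U) (\<lambda>(t, y). g t c y)" "smooth_on (T \<times> U) (\<lambda>(t, y). \<Omega> t c y)"
    and sym: "\<And>t y. t \<in> T \<Longrightarrow> y \<in> U \<Longrightarrow> transpose (g t c y) = g t c y"
      "\<And>t y. t \<in> T \<Longrightarrow> y \<in> U \<Longrightarrow> transpose (time_deriv g t c y) = time_deriv g t c y"
    and pos: "\<And>t y. t \<in> T \<Longrightarrow> y \<in> U \<Longrightarrow> det (g t c y) > 0" "\<And>t y. t \<in> T \<Longrightarrow> y \<in> U \<Longrightarrow> \<Omega> t c y > 0"
    and eq1: "\<And>t y. t \<in> T \<Longrightarrow> y \<in> U \<Longrightarrow> time_deriv E t c y + f t c y *\<^sub>R E t c y = 0"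
    and eq2: "\<And>t y. t \<in> T \<Longrightarrow> y \<in> U \<Longrightarrow> time_deriv (time_deriv \<Omega>) t c y
      + 1/4 * (trace (E t c y ** E t c y) - 2 * f t c y * f t c y - \<kappa> t) * \<Omega> t c y = 0"
    and t: "t \<in> T" and s: "s \<in> T"
  defines "N \<equiv> \<lambda>t. \<Omega> t c x * (g t c x *v (nabla_adjoint (g t) (\<Omega> t) (E t) c x + grad (g t) (f t) c x)) $ j"
  shows "N s = N t"
proof -
  let ?g' = "time_deriv g" and ?w' = "time_deriv \<Omega>" and ?w'' = "time_deriv (time_deriv \<Omega>)"
  have nz: "det (g t c y) \<noteq> 0" "\<Omega> t c y \<noteq> 0" if "t \<in> T" "y \<in> U" for t y
    using pos[OF that] by auto
  note smooth' = smooth_on_time_deriv[where h=g and c=c, OF T(1) U(1) smooth(1)]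
    smooth_on_time_deriv[where h=\<Omega> and c=c, OF T(1) U(1) smooth(2)]
  note smooth'' = smooth_on_time_deriv[where h="?w'" and c=c, OF T(1) U(1) smooth'(2)]
  note D = has_derivative_field_slice[where c=c, OF T(1) U]
  note dt = time_deriv_has_vector_derivative(1)[where c=c]
  have g'E: "?g' t c y = g t c y ** E t c y" if "t \<in> T" "y \<in> U" for t y
    by (simp add: E_def endo_def matrix_mul_assoc matrix_inv_cancel nz that)
  have w'f: "?w' t c y = f t c y * \<Omega> t c y" if "t \<in> T" "y \<in> U" for t y
    by (simp add: f_def form_quotient_def nz that)
  have invt: "((\<lambda>t. matrix_inv (g t c y)) has_vector_derivative - (E t c y ** matrix_inv (g t c y))) (at t)"
    if "t \<in> T" "y \<in> U" for t y
    using has_vector_derivative_matrix_inv[OF T(1) that(1) nz(1) dt[where h=g, OF smooth(1) that]] that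
    by (simp add: E_def endo_def)
  have Et: "((\<lambda>t. E t c y) has_vector_derivative - (f t c y *\<^sub>R E t c y)) (at t)"
    if "t \<in> T" "y \<in> U" for t y
  proof -
    from has_vector_derivative_matrix_mult[OF invt[OF that] dt[where h="?g'", OF smooth'(1) that]]
    obtain D where D: "((\<lambda>t. E t c y) has_vector_derivative D) (at t)"
      unfolding E_def endo_def by blast
    then have "time_deriv E t c y = D"
      unfolding time_deriv_def by (rule vector_derivative_at)
    with eq1[OF that] have "D = - (f t c y *\<^sub>R E t c y)"
      by (simp add: eq_neg_iff_add_eq_0)
    with D show ?thesis by simp
  qed
  define P where "P = (\<lambda>t y. \<Omega> t c y *\<^sub>R E t c y)"
  have Pt: "((\<lambda>t. P t y) has_vector_derivative 0) (at t)" if "t \<in> T" "y \<in> U" for t y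
  proof -
    have "((\<lambda>t. \<Omega> t c y) has_vector_derivative f t c y * \<Omega> t c y) (at t)"
      using dt[where h=\<Omega>, OF smooth(2) that] by (simp add: w'f[OF that])
    then have "((\<lambda>t. \<Omega> t c y) has_field_derivative f t c y * \<Omega> t c y) (at t)"
      by (simp add: has_real_derivative_iff_has_vector_derivative)
    from has_vector_derivative_scaleR[OF this Et[OF that]] show ?thesis
      by (simp add: P_def mult.commute)
  qed
  have P_const: "P s y = P t y" if "s \<in> T" "t \<in> T" "y \<in> U" for s t y
    by (rule has_vector_derivative_zero_unique[OF T(2) Pt[OF _ that(3)] that(1,2)])
  define dE where "dE = (\<lambda>t. partial_deriv j (E t c) x)"
  have Ex: "(E t c has_derivative frechet_derivative (E t c) (at x)) (at x)" if "t \<in> T" for t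
  proof -
    have "\<exists>E'. (E t c has_derivative E') (at x)"
      unfolding E_def
      using has_derivative_endo[where g="g t" and v="?g' t" and c=c, OF U nz(1)[OF that]
          D[where h=g, OF smooth(1) that] D[where h="?g'", OF smooth'(1) that]] by blast
    then have "E t c differentiable (at x)" by (simp add: differentiable_def)
    then show ?thesis by (simp add: frechet_derivative_works[symmetric])
  qed
  have dP: "partial_deriv k (P s) x = partial_deriv k (P t) x" if st: "s \<in> T" "t \<in> T" for s t k
  proof -
    obtain P' where P': "(P s has_derivative P') (at x)"
      unfolding P_def using has_derivative_scaleR[OF D[where h=\<Omega>, OF smooth(2) st(1)] Ex[OF st(1)]]
      by blast
    show ?thesis
      unfolding partial_deriv_eqI[OF P']
      by (rule has_derivative_partial_deriv_cong[OF U P_const[OF st] P', symmetric])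
  qed
  define dg where "dg = (\<lambda>t. partial_deriv j (g t c) x)"
  define dw where "dw = (\<lambda>t. partial_deriv j (\<Omega> t c) x)"
  define dw' where "dw' = (\<lambda>t. partial_deriv j (?w' t c) x)"
  \<comment> \<open>The divergence term is constant in time by \<open>dP\<close>; \<open>R\<close> collects the other two terms.\<close>
  define R where "R = (\<lambda>t. 1/2 * trace (matrix_inv (g t c x) ** dg t ** P t x)
      + (dw' t - f t c x * dw t))"
  have NR: "N t = - (\<Sum>k\<in>UNIV. partial_deriv k (P t) x $ k $ j) + R t" if "t \<in> T" for t
    unfolding N_def R_def P_def dg_def dw_def dw'_def E_def f_def
    using F_condition_coordinates[where g="g t" and v="?g' t" and \<Omega>="\<Omega> t" and V="?w' t" and c=c
        and j=j, OF U sym[OF that] pos[OF that]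
        D[where h=g, OF smooth(1) that, THEN differentiableI]
        D[where h="?g'", OF smooth'(1) that, THEN differentiableI]
        D[where h=\<Omega>, OF smooth(2) that, THEN differentiableI]
        D[where h="?w'", OF smooth'(2) that, THEN differentiableI]]
    by simp
  have fx: "(f t c has_derivative (\<lambda>h. (frechet_derivative (?w' t c) (at x) h
       - f t c x * frechet_derivative (\<Omega> t c) (at x) h) / \<Omega> t c x)) (at x)" if "t \<in> T" for t
  proof -
    have "((\<lambda>y. ?w' t c y / \<Omega> t c y) has_derivative (\<lambda>h. (frechet_derivative (?w' t c) (at x) h * \<Omega> t c x
       - ?w' t c x * frechet_derivative (\<Omega> t c) (at x) h) / (\<Omega> t c x * \<Omega> t c x))) (at x)"
      by (rule has_derivative_divide'[OF D[where h="?w'", OF smooth'(2) that]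
            D[where h=\<Omega>, OF smooth(2) that] nz(2)[OF that U(2)]])
    then show ?thesis
      using nz(2)[OF that U(2)]
      by (simp add: f_def form_quotient_def[abs_def] field_simps)
  qed
  have dg': "partial_deriv j (?g' t c) x = g t c x ** dE t + dg t ** E t c x" if "t \<in> T" for t
    unfolding dE_def dg_def partial_deriv_def[of j "E t c"] partial_deriv_def[of j "g t c"]
    by (rule has_derivative_partial_deriv_cong[OF U _
          has_derivative_matrix_mult[OF D[where h=g, OF smooth(1) that] Ex[OF that]]])
      (simp add: g'E that)
  \<comment> \<open>The second equation, solved for \<open>\<Omega>''\<close> and differentiated in direction \<open>j\<close>; its factor \<open>\<Omega>\<close>
    contributes the last summand.\<close>
  have dw'': "partial_deriv j (?w'' t c) x =
      - (1/2 * trace (dE t ** E t c x)) * \<Omega> t c x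
      + f t c x * (dw' t - f t c x * dw t) + ?w'' t c x / \<Omega> t c x * dw t" if t: "t \<in> T" for t
  proof -
    let ?S = "\<lambda>y. - (1/4 * (trace (E t c y ** E t c y) - 2 * (f t c y * f t c y) - \<kappa> t))"
    let ?S' = "\<lambda>h. - (1/4 * (trace (E t c x ** frechet_derivative (E t c) (at x) h
            + frechet_derivative (E t c) (at x) h ** E t c x)
          - 2 * (f t c x * ((frechet_derivative (?w' t c) (at x) h
       - f t c x * frechet_derivative (\<Omega> t c) (at x) h) / \<Omega> t c x)
          + (frechet_derivative (?w' t c) (at x) h
       - f t c x * frechet_derivative (\<Omega> t c) (at x) h) / \<Omega> t c x * f t c x) - 0))"
    have S: "(?S has_derivative ?S') (at x)"
      by (intro has_derivative_minus has_derivative_mult_right has_derivative_diff has_derivative_const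
          bounded_linear.has_derivative[OF bounded_linear_trace] has_derivative_matrix_mult
          has_derivative_mult Ex[OF t] fx[OF t])
    have w'': "?w'' t c y = ?S y * \<Omega> t c y" if "y \<in> U" for y
      using eq2[OF t that] by (simp add: algebra_simps)
    have "partial_deriv j (?w'' t c) x = ?S x * frechet_derivative (\<Omega> t c) (at x) (axis j 1)
        + ?S' (axis j 1) * \<Omega> t c x"
      by (rule has_derivative_partial_deriv_cong[OF U _
            has_derivative_mult[OF S D[where h=\<Omega>, OF smooth(2) t]]]) (rule w''[symmetric])
    also have "?S x = ?w'' t c x / \<Omega> t c x"
      using w''[OF U(2)] nz(2)[OF t U(2)] by simp
    also have "?S' (axis j 1) = - (1/2 * trace (dE t ** E t c x))
        + f t c x * (dw' t - f t c x * dw t) / \<Omega> t c x"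
      unfolding dE_def dw'_def dw_def partial_deriv_def using nz(2)[OF t U(2)]
      by (simp add: linear_add[OF bounded_linear.linear[OF bounded_linear_trace]]
          trace_mul_sym[of "E t c x"] field_simps)
    finally show ?thesis
      using nz(2)[OF t U(2)] by (simp add: dw_def partial_deriv_def distrib_right left_diff_distrib)
  qed
  note mix = time_deriv_partial_commute[where c=c and x=x and v="axis j 1", folded partial_deriv_def, OF T(1) U(1)]
  have "(R has_vector_derivative 0) (at t)" if t: "t \<in> T" for t
  proof -
    let ?G = "matrix_inv (g t c x)" and ?E = "E t c x" and ?w = "\<Omega> t c x"
    have dgt: "(dg has_vector_derivative partial_deriv j (?g' t c) x) (at t)"
      unfolding dg_def by (rule mix[where h=g, OF smooth(1) t U(2)])
    have dwt: "(dw has_field_derivative dw' t) (at t)"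
      unfolding dw_def dw'_def has_real_derivative_iff_has_vector_derivative
      by (rule mix[where h=\<Omega>, OF smooth(2) t U(2)])
    have dw't: "(dw' has_field_derivative partial_deriv j (?w'' t c) x) (at t)"
      unfolding dw'_def has_real_derivative_iff_has_vector_derivative
      by (rule mix[where h="?w'", OF smooth'(2) t U(2)])
    have wt: "((\<lambda>s. \<Omega> s c x) has_field_derivative ?w' t c x) (at t)"
      unfolding has_real_derivative_iff_has_vector_derivative
      by (rule dt[where h=\<Omega>, OF smooth(2) t U(2)])
    have w't: "((\<lambda>s. ?w' s c x) has_field_derivative ?w'' t c x) (at t)"
      unfolding has_real_derivative_iff_has_vector_derivative
      by (rule dt[where h="?w'", OF smooth'(2) t U(2)])
    have ft: "((\<lambda>s. f s c x) has_field_derivative ?w'' t c x / ?w - f t c x * f t c x) (at t)"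
    proof -
      have "((\<lambda>s. ?w' s c x / \<Omega> s c x) has_field_derivative
        (?w'' t c x * ?w - ?w' t c x * ?w' t c x) / (?w * ?w)) (at t)"
        by (rule DERIV_divide[OF w't wt nz(2)[OF t U(2)]])
      then show ?thesis
        using nz(2)[OF t U(2)] by (simp add: f_def form_quotient_def field_simps)
    qed
    let ?M = "?G ** dg t ** 0 + (?G ** partial_deriv j (?g' t c) x + (- (?E ** ?G)) ** dg t) ** P t x"
    have "((\<lambda>s. trace (matrix_inv (g s c x) ** dg s ** P s x)) has_field_derivative trace ?M) (at t)"
      unfolding has_real_derivative_iff_has_vector_derivative
      by (intro bounded_linear.has_vector_derivative[OF bounded_linear_trace]
          has_vector_derivative_matrix_mult invt dgt Pt t U(2))
    \<comment> \<open>Differentiating \<open>g' = gE\<close> in direction \<open>j\<close> produces \<open>\<partial>\<^sub>jE\<close>; the remaining terms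
      form a commutator, which is traceless.\<close>
    moreover have "trace ?M = ?w * trace (dE t ** ?E)"
    proof -
      have "?G ** partial_deriv j (?g' t c) x = dE t + ?G ** dg t ** ?E"
        unfolding dg'[OF t]
        by (simp add: matrix_mult_linear_simps matrix_mul_assoc matrix_inv_cancel nz[OF t U(2)])
      then have "?M = ?w *\<^sub>R (dE t ** ?E) + ?w *\<^sub>R ((?G ** dg t ** ?E) ** ?E - ?E ** (?G ** dg t ** ?E))"
        by (simp add: P_def matrix_mult_linear_simps matrix_mul_assoc scaleR_add_right scaleR_diff_right)
      then show ?thesis
        by (simp add: linear_add[OF bounded_linear.linear[OF bounded_linear_trace]]
            linear_diff[OF bounded_linear.linear[OF bounded_linear_trace]]
            linear_scale[OF bounded_linear.linear[OF bounded_linear_trace]]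
            trace_mul_sym[of ?E])
    qed
    ultimately have tr: "((\<lambda>s. trace (matrix_inv (g s c x) ** dg s ** P s x)) has_field_derivative
        ?w * trace (dE t ** ?E)) (at t)"
      by simp
    have "(R has_field_derivative 1/2 * (?w * trace (dE t ** ?E))
       + (partial_deriv j (?w'' t c) x
          - (f t c x * dw' t + (?w'' t c x / ?w - f t c x * f t c x) * dw t))) (at t)"
      unfolding R_def
      by (intro DERIV_add DERIV_diff DERIV_cmult tr dw't DERIV_mult' ft dwt)
    moreover have "1/2 * (?w * trace (dE t ** ?E)) + (partial_deriv j (?w'' t c) x
          - (f t c x * dw' t + (?w'' t c x / ?w - f t c x * f t c x) * dw t)) = 0"
      unfolding dw''[OF t] by (simp add: algebra_simps)
    ultimately show ?thesis
      by (simp add: has_real_derivative_iff_has_vector_derivative)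
  qed
  then have "R s = R t"
    by (rule has_vector_derivative_zero_unique[OF T(2) _ s t])
  then show ?thesis
    by (simp only: NR[OF s] NR[OF t] dP[OF s t])
qed


section \<open>Tangent vectors of smooth paths\<close>

text \<open>A compact Hausdorff space is normal. Urysohn's lemma gives every point a bump function supported in
the domain of some chart. By compactness, finitely many of them have no common zero; those that belong
to the same chart are added up and divided by the total sum.\<close>

lemma partition_of_unity_exists:
  fixes A :: "('a::t2_space, 'm::finite) chart set"
  assumes comp: "compact (UNIV :: 'a set)" and op: "\<And>c. c \<in> A \<Longrightarrow> open (fst c)"
    and cover: "(\<Union>c\<in>A. fst c) = UNIV"
  shows "\<exists>P. partition_of_unity A P"
proof -
  have "Hausdorff_space (euclidean :: 'a topology)"
    unfolding Hausdorff_space_def disjnt_def using hausdorff by simp blast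
  then have norm: "normal_space (euclidean :: 'a topology)"
    using comp by (intro compact_Hausdorff_or_regular_imp_normal_space) (auto simp: compact_space_def)
  have "\<exists>c f. c \<in> A \<and> continuous_on UNIV f \<and> (\<forall>q. 0 \<le> f q) \<and> f p = (1::real) \<and>
      closure {q. f q \<noteq> 0} \<subseteq> fst c" for p :: 'a
  proof -
    obtain c where c: "c \<in> A" "p \<in> fst c" using cover by blast
    obtain V W where V: "open V" "open W" "{p} \<subseteq> V" "- fst c \<subseteq> W" "disjnt V W"
      using norm[unfolded normal_space_def, rule_format, of "{p}" "- fst c"] c op[OF c(1)]
      by (auto simp: disjnt_def)
    obtain f :: "'a \<Rightarrow> real" where f: "continuous_map euclidean (top_of_set {0..1}) f"
      "f ` (- V) \<subseteq> {0}" "f ` {p} \<subseteq> {1}"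
      by (rule Urysohn_lemma[OF norm, of "- V" "{p}" 0 1]) (use V in \<open>auto simp: disjnt_def\<close>)
    have "{q. f q \<noteq> 0} \<subseteq> - W"
    proof
      fix q assume "q \<in> {q. f q \<noteq> 0}"
      then have "q \<in> V" using f(2) by auto
      then show "q \<in> - W" using V(5) by (auto simp: disjnt_def)
    qed
    then have "closure {q. f q \<noteq> 0} \<subseteq> - W"
      using V(2) by (intro closure_minimal) auto
    moreover have "continuous_on UNIV f" "\<forall>q. 0 \<le> f q"
      using f(1) by (auto simp: continuous_map_in_subtopology)
    moreover have "f p = 1" using f(3) by simp
    ultimately show ?thesis
      using c(1) V(4) by (intro exI[of _ c] exI[of _ f] conjI) auto
  qed
  then obtain ch f where chf: "\<And>p. ch p \<in> A" "\<And>p. continuous_on UNIV (f p)"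
      "\<And>p q. 0 \<le> f p q" "\<And>p. f p p = (1::real)" "\<And>p. closure {q. f p q \<noteq> 0} \<subseteq> fst (ch p)"
    by metis
  have "open {q. f p q > 0}" for p
    using open_Collect_less[OF continuous_on_const chf(2)[of p], of 0] by simp
  moreover have "UNIV \<subseteq> (\<Union>p. {q. f p q > 0})"
    using chf(4) by (auto intro!: exI simp: zero_less_one)
  ultimately obtain D where D: "finite D" "UNIV \<subseteq> (\<Union>p\<in>D. {q. f p q > 0})"
    using compactE_image[OF comp, of UNIV "\<lambda>p. {q. f p q > 0}"] by (metis subset_UNIV)
  define s where "s = (\<lambda>q. \<Sum>p\<in>D. f p q)"
  have s: "s q > 0" for q
  proof -
    obtain p where "p \<in> D" "f p q > 0" using D by blast
    then show ?thesis
      unfolding s_def using D(1) chf(3) by (intro sum_pos2[of D p]) auto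
  qed
  define \<rho> where "\<rho> = (\<lambda>c q. (\<Sum>p\<in>{p\<in>D. ch p = c}. f p q) / s q)"
  have "partition_of_unity A (ch ` D, \<rho>)"
    unfolding partition_of_unity_def
  proof (simp only: prod.case, intro conjI ballI allI)
    show "finite (ch ` D)" "ch ` D \<subseteq> A" using D chf by auto
    fix c assume "c \<in> ch ` D"
    have "continuous_on UNIV s"
      unfolding s_def by (intro continuous_on_sum chf(2))
    then show "continuous_on UNIV (\<rho> c)"
      unfolding \<rho>_def using s
      by (intro continuous_on_divide continuous_on_sum chf(2)) (auto simp: less_imp_neq[symmetric])
    show "0 \<le> \<rho> c p" for p
      unfolding \<rho>_def using s[of p] by (intro divide_nonneg_pos sum_nonneg chf(3))
    have "{p. \<rho> c p \<noteq> 0} \<subseteq> (\<Union>p\<in>{p\<in>D. ch p = c}. closure {q. f p q \<noteq> 0})"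
    proof
      fix q assume "q \<in> {p. \<rho> c p \<noteq> 0}"
      then have "(\<Sum>p\<in>{p\<in>D. ch p = c}. f p q) \<noteq> 0" by (auto simp: \<rho>_def)
      then obtain p where "p \<in> {p\<in>D. ch p = c}" "f p q \<noteq> 0"
        by (metis (mono_tags, lifting) sum.neutral)
      then show "q \<in> (\<Union>p\<in>{p\<in>D. ch p = c}. closure {q. f p q \<noteq> 0})"
        using closure_subset[of "{q. f p q \<noteq> 0}"] by blast
    qed
    moreover have "closed (\<Union>p\<in>{p\<in>D. ch p = c}. closure {q. f p q \<noteq> 0})"
      using D(1) by (intro closed_UN) auto
    ultimately have "closure {p. \<rho> c p \<noteq> 0} \<subseteq> (\<Union>p\<in>{p\<in>D. ch p = c}. closure {q. f p q \<noteq> 0})"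
      by (rule closure_minimal)
    also have "\<dots> \<subseteq> fst c" using chf(5) by blast
    finally show "closure {p. \<rho> c p \<noteq> 0} \<subseteq> fst c" .
  next
    fix q
    have "(\<Sum>c\<in>ch ` D. \<Sum>p\<in>{p\<in>D. ch p = c}. f p q) = s q"
      unfolding s_def by (rule sum.image_gen[OF D(1), symmetric])
    then show "(\<Sum>c\<in>ch ` D. \<rho> c q) = 1"
      using s[of q] by (simp add: \<rho>_def sum_divide_distrib[symmetric])
  qed
  then show ?thesis ..
qed

text \<open>Since the cutoff \<open>\<phi>\<close> is supported in the compact set \<open>K\<close>, the integrand extends by zero to a
continuous function on the whole space, and the integral over \<open>U\<close> becomes one over a box, where
differentiation under the integral applies.\<close>

lemma has_derivative_integral_cutoff:
  fixes \<phi> :: "'b::euclidean_space \<Rightarrow> real" and h h' :: "real \<Rightarrow> 'b \<Rightarrow> real"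
  assumes U: "open U" and K: "compact K" "K \<subseteq> U" and T: "open T" "convex T" "t \<in> T"
    and \<phi>: "continuous_on U \<phi>" "\<And>x. x \<in> U \<Longrightarrow> x \<notin> K \<Longrightarrow> \<phi> x = 0"
    and h: "continuous_on (T \<times> U) (\<lambda>(t, x). h t x)" "continuous_on (T \<times> U) (\<lambda>(t, x). h' t x)"
    and d: "\<And>t x. t \<in> T \<Longrightarrow> x \<in> U \<Longrightarrow> ((\<lambda>s. h s x) has_field_derivative h' t x) (at t)"
  shows "((\<lambda>s. integral U (\<lambda>x. \<phi> x * h s x)) has_field_derivative
    integral U (\<lambda>x. \<phi> x * h' t x)) (at t)"
proof -
  obtain a b where ab: "K \<subseteq> cbox a b"
    using compact_imp_bounded[OF K(1)] bounded_subset_cbox_symmetric by blast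
  define ext where "ext = (\<lambda>k :: real \<Rightarrow> 'b \<Rightarrow> real. \<lambda>s x. if x \<in> U then \<phi> x * k s x else 0)"
  have int: "integral (cbox a b) (ext k s) = integral U (\<lambda>x. \<phi> x * k s x)" for k s
  proof -
    have "integral (cbox a b) (ext k s) = integral UNIV (\<lambda>x. if x \<in> cbox a b then ext k s x else 0)"
      by (simp add: integral_restrict_UNIV)
    also have "(\<lambda>x. if x \<in> cbox a b then ext k s x else 0) = (\<lambda>x. if x \<in> U then \<phi> x * k s x else 0)"
      using ab \<phi>(2) by (auto simp: ext_def fun_eq_iff)
    also have "integral UNIV \<dots> = integral U (\<lambda>x. \<phi> x * k s x)"
      by (simp add: integral_restrict_UNIV)
    finally show ?thesis .
  qed
  have cont: "continuous_on (T \<times> cbox a b) (\<lambda>(s, x). ext k s x)"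
    if k: "continuous_on (T \<times> U) (\<lambda>(s, x). k s x)" for k
  proof -
    have "continuous_on (T \<times> U \<union> T \<times> (- K)) (\<lambda>(s, x). ext k s x)"
    proof (rule continuous_on_open_Un)
      show "open (T \<times> U)" "open (T \<times> (- K))"
        using T U compact_imp_closed[OF K(1)] by (auto intro!: open_Times)
      have "continuous_on (T \<times> U) (\<lambda>p. \<phi> (snd p) * (\<lambda>(s, x). k s x) p)"
        by (intro continuous_on_mult k continuous_on_compose2[OF \<phi>(1)] continuous_intros) auto
      then show "continuous_on (T \<times> U) (\<lambda>(s, x). ext k s x)"
        by (rule continuous_on_eq) (auto simp: ext_def)
      have "continuous_on (T \<times> (- K)) (\<lambda>p :: real \<times> 'b. 0 :: real)" by (rule continuous_on_const)
      then show "continuous_on (T \<times> (- K)) (\<lambda>(s, x). ext k s x)"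
        by (rule continuous_on_eq) (auto simp: ext_def \<phi>(2))
    qed
    then show ?thesis
      by (rule continuous_on_subset) (use K in auto)
  qed
  have "((\<lambda>s. integral (cbox a b) (ext h s)) has_field_derivative integral (cbox a b) (ext h' t))
      (at t within T)"
  proof (rule leibniz_rule_field_derivative)
    fix s x assume s: "s \<in> T" and "x \<in> cbox a b"
    show "((\<lambda>s. ext h s x) has_field_derivative ext h' s x) (at s within T)"
      using d[OF s, of x] by (cases "x \<in> U")
        (auto simp: ext_def intro!: DERIV_cmult intro: has_field_derivative_at_within)
  next
    fix s assume "s \<in> T"
    then have "continuous_on (cbox a b) (\<lambda>x. (\<lambda>(s, x). ext h s x) (s, x))"
      by (intro continuous_on_compose2[OF cont[OF h(1)]] continuous_intros) auto
    then show "ext h s integrable_on cbox a b"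
      by (intro integrable_continuous) simp
  qed (use T cont[OF h(2)] in auto)
  then show ?thesis
    using at_within_open[OF T(3,1)] by (simp add: int)
qed

text \<open>The integral is defined by some chosen partition of unity; the existence of one ensures that
the choice has the properties of a partition, and then every summand is covered by
\<open>has_derivative_integral_cutoff\<close>.\<close>

lemma form_integral_has_derivative:
  fixes A :: "('a::t2_space, 'm::finite) chart set"
  assumes A: "compact_oriented_manifold A" and T: "open T" "convex T" "t \<in> T"
    and smooth: "\<And>c. c \<in> A \<Longrightarrow> smooth_on (T \<times> chart_image c) (\<lambda>(s, x). h s c x)"
  shows "((\<lambda>s. form_integral A (h s)) has_field_derivative form_integral A (time_deriv h t)) (at t)"
proof -
  have comp: "compact (UNIV :: 'a set)" and chart: "\<And>c. c \<in> A \<Longrightarrow> is_chart c"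
    and cover: "(\<Union>c\<in>A. fst c) = UNIV"
    using A by (auto simp: compact_oriented_manifold_def oriented_smooth_atlas_def)
  have "\<exists>P. partition_of_unity A P"
    by (rule partition_of_unity_exists[OF comp _ cover]) (use chart in \<open>auto simp: is_chart_def\<close>)
  then have P: "partition_of_unity A (SOME P. partition_of_unity A P)" by (rule someI_ex)
  obtain C \<rho> where C\<rho>: "(SOME P. partition_of_unity A P) = (C, \<rho>)" by fastforce
  have fin: "finite C" "C \<subseteq> A"
    and \<rho>: "\<And>c. c \<in> C \<Longrightarrow> continuous_on UNIV (\<rho> c)" "\<And>c. c \<in> C \<Longrightarrow> closure {p. \<rho> c p \<noteq> 0} \<subseteq> fst c"
    using P[unfolded C\<rho>] by (auto simp: partition_of_unity_def)
  have fi: "form_integral A V = (\<Sum>c\<in>C. integral (chart_image c) (\<lambda>x. \<rho> c (chart_inv c x) * V c x))" for V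
    unfolding form_integral_def C\<rho> by simp
  have "((\<lambda>s. integral (chart_image c) (\<lambda>x. \<rho> c (chart_inv c x) * h s c x)) has_field_derivative
    integral (chart_image c) (\<lambda>x. \<rho> c (chart_inv c x) * time_deriv h t c x)) (at t)" if c: "c \<in> C" for c
  proof -
    have cA: "c \<in> A" using c fin by auto
    have hom: "homeomorphism (fst c) (chart_image c) (snd c) (chart_inv c)"
      and op: "open (chart_image c)"
      using chart[OF cA] by (auto simp: is_chart_def)
    let ?K = "snd c ` closure {p. \<rho> c p \<noteq> 0}"
    show ?thesis
    proof (rule has_derivative_integral_cutoff[where K="?K" and T=T])
      have "compact (closure {p. \<rho> c p \<noteq> 0})"
        using compact_Int_closed[OF comp closed_closure] by simp
      then show "compact ?K"
        by (rule compact_continuous_image[rotated])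
          (use hom \<rho>(2)[OF c] in \<open>auto simp: homeomorphism_def elim: continuous_on_subset\<close>)
      show "?K \<subseteq> chart_image c" using \<rho>(2)[OF c] by (auto simp: chart_image_def)
      show "continuous_on (chart_image c) (\<lambda>x. \<rho> c (chart_inv c x))"
        using hom by (intro continuous_on_compose2[OF \<rho>(1)[OF c]]) (auto simp: homeomorphism_def)
      show "\<rho> c (chart_inv c x) = 0" if "x \<in> chart_image c" "x \<notin> ?K" for x
      proof (rule ccontr)
        assume "\<rho> c (chart_inv c x) \<noteq> 0"
        then have "chart_inv c x \<in> closure {p. \<rho> c p \<noteq> 0}"
          using closure_subset by fastforce
        moreover have "snd c (chart_inv c x) = x"
          using hom that(1) by (simp add: homeomorphism_def)
        ultimately show False using that(2) by force
      qed
      show "continuous_on (T \<times> chart_image c) (\<lambda>(t, x). h t c x)"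
        by (rule smooth_on_imp_continuous_on[OF smooth[OF cA]])
      show "continuous_on (T \<times> chart_image c) (\<lambda>(t, x). time_deriv h t c x)"
        by (rule smooth_on_imp_continuous_on, rule smooth_on_time_deriv) (fact T op smooth[OF cA])+
      show "((\<lambda>s. h s c x) has_field_derivative time_deriv h s c x) (at s)"
        if "s \<in> T" "x \<in> chart_image c" for s x
        unfolding has_real_derivative_iff_has_vector_derivative
        by (rule time_deriv_has_vector_derivative(1)[where h=h and c=c, OF smooth[OF cA] that])
    qed (fact op T)+
  qed
  then show ?thesis
    unfolding fi by (rule DERIV_sum)
qed

lemma time_deriv_linear_relation:
  assumes L: "bounded_linear L" and T: "open T" "t \<in> T"
    and rel: "\<And>s. s \<in> T \<Longrightarrow> h s c x = L (h s d y)"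
    and hd: "((\<lambda>s. h s d y) has_vector_derivative time_deriv h t d y) (at t)"
  shows "time_deriv h t c x = L (time_deriv h t d y)"
proof -
  have "((\<lambda>s. L (h s d y)) has_vector_derivative L (time_deriv h t d y)) (at t)"
    by (rule bounded_linear.has_vector_derivative[OF L hd])
  then have "((\<lambda>s. h s c x) has_vector_derivative L (time_deriv h t d y)) (at t)"
    by (rule has_vector_derivative_transform_within_open[OF _ T]) (simp add: rel)
  then show ?thesis
    unfolding time_deriv_def[of h t c x] by (rule vector_derivative_at)
qed

lemma overlap_in_chart_images:
  assumes "is_chart c" "x \<in> overlap c d"
  shows "x \<in> chart_image c" "transition c d x \<in> chart_image d"
proof -
  obtain p where p: "p \<in> fst c" "p \<in> fst d" "x = snd c p"
    using assms(2) by (auto simp: overlap_def)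
  then have "chart_inv c x = p"
    using assms(1) by (simp add: is_chart_def homeomorphism_def)
  with p show "x \<in> chart_image c" "transition c d x \<in> chart_image d"
    by (auto simp: chart_image_def transition_def)
qed

text \<open>Symmetry and the transformation laws are linear relations between values of a field at a fixed
point, so the velocity inherits them. Its integral vanishes because the volume forms all have
integral one.\<close>

lemma smooth_path_velocity_tangent:
  fixes A :: "('a::t2_space, 'm::finite) chart set"
  assumes A: "compact_oriented_manifold A" and path: "smooth_path A \<epsilon> g \<Omega>" and t: "t \<in> {-\<epsilon><..<\<epsilon>}"
  shows "(time_deriv g t, time_deriv \<Omega> t) \<in> tangent_space A"
proof -
  let ?T = "{-\<epsilon><..<\<epsilon>}"
  have chart: "\<And>c. c \<in> A \<Longrightarrow> is_chart c"
    using A by (auto simp: compact_oriented_manifold_def oriented_smooth_atlas_def)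
  then have op: "\<And>c. c \<in> A \<Longrightarrow> open (chart_image c)" by (simp add: is_chart_def)
  have sm: "smooth_on (?T \<times> chart_image c) (\<lambda>(t, x). g t c x)"
    "smooth_on (?T \<times> chart_image c) (\<lambda>(t, x). \<Omega> t c x)" if "c \<in> A" for c
    using path that by (auto simp: smooth_path_def)
  have gs: "g s \<in> symmetric_tensors A" and \<Omega>s: "\<Omega> s \<in> top_forms A" "form_integral A (\<Omega> s) = 1"
    if "s \<in> ?T" for s
    using path that by (auto simp: smooth_path_def riemannian_metrics_def unit_volume_forms_def)
  have oT: "open ?T" by simp
  have dg: "((\<lambda>s. g s c x) has_vector_derivative time_deriv g t c x) (at t)"
    and d\<Omega>: "((\<lambda>s. \<Omega> s c x) has_vector_derivative time_deriv \<Omega> t c x) (at t)"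
    if "c \<in> A" "x \<in> chart_image c" for c x
    using time_deriv_has_vector_derivative(1)[where h=g and c=c, OF sm(1)[OF that(1)] t that(2)]
      time_deriv_has_vector_derivative(1)[where h=\<Omega> and c=c, OF sm(2)[OF that(1)] t that(2)] by auto
  have "time_deriv g t \<in> symmetric_tensors A"
    unfolding symmetric_tensors_def
  proof (rule CollectI, intro ballI conjI)
    fix c assume c: "c \<in> A"
    show "smooth_on (chart_image c) (time_deriv g t c)"
      by (rule smooth_on_field_slice[where h="time_deriv g",
            OF smooth_on_time_deriv[where h=g, OF oT op[OF c] sm(1)[OF c]] oT op[OF c] t])
    show "transpose (time_deriv g t c x) = time_deriv g t c x" if x: "x \<in> chart_image c" for x
      by (rule time_deriv_linear_relation[OF bounded_linear_transpose oT t _ dg[OF c x], symmetric])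
        (use gs c x in \<open>auto simp: symmetric_tensors_def\<close>)
    fix d x assume d: "d \<in> A" and x: "x \<in> overlap c d"
    let ?J = "transition_jacobian c d x"
    have L: "bounded_linear (\<lambda>M. transpose ?J ** M ** ?J)"
      by (intro bounded_linear_compose[OF bounded_bilinear.bounded_linear_left[OF bounded_bilinear_matrix_mult]
            bounded_bilinear.bounded_linear_right[OF bounded_bilinear_matrix_mult]])
    show "time_deriv g t c x = transpose ?J ** time_deriv g t d (transition c d x) ** ?J"
      by (rule time_deriv_linear_relation[OF L oT t _ dg[OF d overlap_in_chart_images(2)[OF chart[OF c] x]]])
        (use gs c d x in \<open>auto simp: symmetric_tensors_def\<close>)
  qed
  moreover have "time_deriv \<Omega> t \<in> top_forms A"
    unfolding top_forms_def
  proof (rule CollectI, intro ballI conjI)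
    fix c assume c: "c \<in> A"
    show "smooth_on (chart_image c) (time_deriv \<Omega> t c)"
      by (rule smooth_on_field_slice[where h="time_deriv \<Omega>",
            OF smooth_on_time_deriv[where h=\<Omega>, OF oT op[OF c] sm(2)[OF c]] oT op[OF c] t])
    fix d x assume d: "d \<in> A" and x: "x \<in> overlap c d"
    let ?J = "transition_jacobian c d x"
    show "time_deriv \<Omega> t c x = det ?J * time_deriv \<Omega> t d (transition c d x)"
      by (rule time_deriv_linear_relation[OF bounded_linear_mult_right oT t _
            d\<Omega>[OF d overlap_in_chart_images(2)[OF chart[OF c] x]]])
        (use \<Omega>s c d x in \<open>auto simp: top_forms_def\<close>)
  qed
  moreover have "form_integral A (time_deriv \<Omega> t) = 0"
  proof -
    have "((\<lambda>s. form_integral A (\<Omega> s)) has_field_derivative form_integral A (time_deriv \<Omega> t)) (at t)"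
      by (rule form_integral_has_derivative[OF A oT _ t sm(2)]) auto
    then have "((\<lambda>s. 1 :: real) has_field_derivative form_integral A (time_deriv \<Omega> t)) (at t)"
      by (rule has_field_derivative_transform_within_open[OF _ oT t]) (simp add: \<Omega>s)
    then show ?thesis using DERIV_unique[OF _ DERIV_const] by blast
  qed
  ultimately show ?thesis by (simp add: tangent_space_def)
qed


section \<open>Geodesics tangent to \<open>F\<close>\<close>

theorem proposition1:
  fixes A :: "('a::t2_space, 'm::finite) chart set"
    and \<epsilon> :: real
    and g :: "real \<Rightarrow> ('a, 'm) matrix_field"
    and \<Omega> :: "real \<Rightarrow> ('a, 'm) scalar_field"
  assumes "compact_oriented_manifold A"
    and "\<epsilon> > 0"
    and "G_geodesic A \<epsilon> g \<Omega>"
    and "(time_deriv g 0, time_deriv \<Omega> 0) \<in> F_space A (g 0) (\<Omega> 0)"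
  shows "\<forall>t\<in>{-\<epsilon><..<\<epsilon>}. (time_deriv g t, time_deriv \<Omega> t) \<in> F_space A (g t) (\<Omega> t)"
proof
  fix t assume t: "t \<in> {-\<epsilon><..<\<epsilon>}"
  let ?T = "{-\<epsilon><..<\<epsilon>}"
  let ?Z = "\<lambda>t c x. nabla_adjoint (g t) (\<Omega> t) (endo (g t) (time_deriv g t)) c x
    + grad (g t) (form_quotient (\<Omega> t) (time_deriv \<Omega> t)) c x"
  have path: "smooth_path A \<epsilon> g \<Omega>" using assms(3) by (simp add: G_geodesic_def)
  have oT: "open ?T" and cT: "convex ?T" and T0: "0 \<in> ?T" using \<open>\<epsilon> > 0\<close> by auto
  note tangent = smooth_path_velocity_tangent[OF assms(1) path]
  have "?Z t c x = 0" if c: "c \<in> A" and x: "x \<in> chart_image c" for c x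
  proof -
    have op: "open (chart_image c)"
      using assms(1) c by (auto simp: compact_oriented_manifold_def oriented_smooth_atlas_def is_chart_def)
    have metric: "g s \<in> riemannian_metrics A" "\<Omega> s \<in> unit_volume_forms A" if "s \<in> ?T" for s
      using path that by (auto simp: smooth_path_def)
    have det: "det (g s c y) > 0" if "s \<in> ?T" "y \<in> chart_image c" for s y
      using metric(1)[OF that(1)] c that(2)
      by (intro positive_definite_imp_det_pos) (auto simp: riemannian_metrics_def)
    have pos: "\<Omega> s c y > 0" if "s \<in> ?T" "y \<in> chart_image c" for s y
      using metric(2)[OF that(1)] c that(2) by (auto simp: unit_volume_forms_def)
    \<comment> \<open>The integral in the second geodesic equation is the function \<open>\<kappa>\<close> of time.\<close>
    have "\<Omega> t c x * (g t c x *v ?Z t c x) $ j = \<Omega> 0 c x * (g 0 c x *v ?Z 0 c x) $ j" for j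
    proof (rule F_condition_conserved[where T="?T" and U="chart_image c"
          and \<kappa>="\<lambda>t. G_metric A (g t) (\<Omega> t) (time_deriv g t, time_deriv \<Omega> t) (time_deriv g t, time_deriv \<Omega> t)"])
      fix s y assume s: "s \<in> ?T" and y: "y \<in> chart_image c"
      show "transpose (g s c y) = g s c y"
        using metric(1)[OF s] c y by (auto simp: riemannian_metrics_def symmetric_tensors_def)
      show "transpose (time_deriv g s c y) = time_deriv g s c y"
        using tangent[OF s] c y by (auto simp: tangent_space_def symmetric_tensors_def)
      show "det (g s c y) > 0" "\<Omega> s c y > 0" using det pos s y by auto
      note eqs = assms(3)[unfolded G_geodesic_def, THEN conjunct2, rule_format, OF s c y]
      show "time_deriv (\<lambda>t. endo (g t) (time_deriv g t)) s c y
          + form_quotient (\<Omega> s) (time_deriv \<Omega> s) c y *\<^sub>R endo (g s) (time_deriv g s) c y = 0"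
        using eqs by simp
      show "time_deriv (time_deriv \<Omega>) s c y + 1/4 *
          (trace (endo (g s) (time_deriv g s) c y ** endo (g s) (time_deriv g s) c y)
            - 2 * form_quotient (\<Omega> s) (time_deriv \<Omega> s) c y * form_quotient (\<Omega> s) (time_deriv \<Omega> s) c y
            - G_metric A (g s) (\<Omega> s) (time_deriv g s, time_deriv \<Omega> s) (time_deriv g s, time_deriv \<Omega> s))
          * \<Omega> s c y = 0"
        using eqs by (simp add: G_density_def tensor_inner_def)
    next
      show "smooth_on (?T \<times> chart_image c) (\<lambda>(t, y). g t c y)"
        "smooth_on (?T \<times> chart_image c) (\<lambda>(t, y). \<Omega> t c y)"
        using path c by (auto simp: smooth_path_def)
    qed (fact oT cT op x t T0)+
    moreover have "?Z 0 c x = 0"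
      using assms(4) c x by (simp add: F_space_def)
    ultimately have "g t c x *v ?Z t c x = 0"
      using pos[OF t x] by (simp add: vec_eq_iff)
    then have "(matrix_inv (g t c x) ** g t c x) *v ?Z t c x = 0"
      by (simp add: matrix_vector_mul_assoc[symmetric])
    then show ?thesis
      using det[OF t x] by (simp add: matrix_inv_cancel)
  qed
  with tangent[OF t] show "(time_deriv g t, time_deriv \<Omega> t) \<in> F_space A (g t) (\<Omega> t)"
    by (simp add: F_space_def)
qed

end
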